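(* If $M$ is a connected $\mathrm{CFPO}_\omega$ then $M$ is treelike.
   Context: Partial orders may carry arbitrarily many unary colour predicates, preserved by automorphisms. For a partial order $M$ let $M^D$ be its Dedekind–MacNeille completion. A connecting set from $a$ to $b$ is a tuple $\langle c_1,\dots,c_n\rangle$ with $c_1=a$, $c_n=b$, $c_2,\dots,c_{n-1}\in M^D$, consecutive entries comparable, and for $1<i<n$ either $c_{i-1}<c_i>c_{i+1}$ or $c_{i-1}>c_i<c_{i+1}$; a path is a union of maximal chains $\sigma_k$ in $M^D$ with endpoints $c_k,c_{k+1}$ ($1\le k<n$) such that $\sigma_i\cap\sigma_j\neq\emptyset$ for $i<j$ only if $j=i+1$ and the intersection is $\{c_{i+1}\}$. A cycle-free partial order (CFPO) has at most one path between any two points; it is connected if there is always one. A tree is a partial order in which each $\{y:y\le x\}$ is a chain and any two elements have a common lower bound. A CFPO $M$ is treelike if there is a coloured tree $T$ with $\mathrm{Aut}(M)\cong\mathrm{Aut}(T)$ as abstract groups. $\mathrm{Alt}$ is the partial order on $\{a_i:i\in\mathbb{Z}\}$ where for $i$ odd $a_{i-1}>a_i<a_{i+1}$, for $i$ even $a_{i-1}<a_i>a_{i+1}$. $\mathrm{Alt}_\omega$ is its restriction to $\{a_i: i\in\omega\}$. A CFPO is a $\mathrm{CFPO}_\omega$ if $\mathrm{Alt}_\omega$ embeds (as an induced suborder) but $\mathrm{Alt}$ does not. *)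

theory Defs
  imports "HOL-Algebra.Bij"
begin

section \<open>Coloured partial orders and their automorphism groups\<close>

text \<open>
  The colours form a set of unary predicates, without an indexing family: an automorphism preserves
  each of them, so neither names nor repetitions affect the automorphism group.
\<close>

record 'a coloured_order = "'a partial_object" +
  ord_rel :: "'a rel"
  colours :: "'a set set"

definition coloured_partial_order :: "'a coloured_order \<Rightarrow> bool" where
  "coloured_partial_order M \<longleftrightarrow> partial_order_on (carrier M) (ord_rel M)"

definition automorphisms :: "'a coloured_order \<Rightarrow> ('a \<Rightarrow> 'a) set" where
  "automorphisms M = {f \<in> Bij (carrier M).
     (\<forall>x \<in> carrier M. \<forall>y \<in> carrier M. (f x, f y) \<in> ord_rel M \<longleftrightarrow> (x, y) \<in> ord_rel M) \<and>
     (\<forall>P \<in> colours M. \<forall>x \<in> carrier M. f x \<in> P \<longleftrightarrow> x \<in> P)}"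

definition Aut :: "'a coloured_order \<Rightarrow> ('a \<Rightarrow> 'a) monoid" where
  "Aut M = BijGroup (carrier M) \<lparr>carrier := automorphisms M\<rparr>"

lemma automorphisms_subgroup: "subgroup (automorphisms M) (BijGroup (carrier M))"
proof (rule group.subgroupI[OF group_BijGroup])
  show "automorphisms M \<subseteq> carrier (BijGroup (carrier M))"
    by (auto simp: automorphisms_def BijGroup_def)
  have "(\<lambda>x\<in>carrier M. x) \<in> automorphisms M"
    by (auto simp: automorphisms_def id_Bij)
  then show "automorphisms M \<noteq> {}" by blast
next
  fix f assume f: "f \<in> automorphisms M"
  then have fB: "f \<in> Bij (carrier M)" by (simp add: automorphisms_def)
  then have surj: "f ` carrier M = carrier M" by (simp add: Bij_def bij_betw_def)
  let ?g = "inv_into (carrier M) f"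
  have g: "?g x \<in> carrier M" "f (?g x) = x" if "x \<in> carrier M" for x
    using that surj by (auto intro: inv_into_into f_inv_into_f)
  have "(?g x, ?g y) \<in> ord_rel M \<longleftrightarrow> (x, y) \<in> ord_rel M"
    if "x \<in> carrier M" "y \<in> carrier M" for x y
  proof -
    have "(f (?g x), f (?g y)) \<in> ord_rel M \<longleftrightarrow> (?g x, ?g y) \<in> ord_rel M"
      using f g(1)[OF that(1)] g(1)[OF that(2)] unfolding automorphisms_def by blast
    then show ?thesis using g(2) that by simp
  qed
  moreover have "?g x \<in> P \<longleftrightarrow> x \<in> P" if "P \<in> colours M" "x \<in> carrier M" for P x
  proof -
    have "f (?g x) \<in> P \<longleftrightarrow> ?g x \<in> P"
      using f that(1) g(1)[OF that(2)] unfolding automorphisms_def by blast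
    then show ?thesis using g(2) that by simp
  qed
  ultimately show "inv\<^bsub>BijGroup (carrier M)\<^esub> f \<in> automorphisms M"
    using fB by (simp add: inv_BijGroup automorphisms_def restrict_inv_into_Bij)
next
  fix f g assume fg: "f \<in> automorphisms M" "g \<in> automorphisms M"
  then have B: "f \<in> Bij (carrier M)" "g \<in> Bij (carrier M)"
    by (simp_all add: automorphisms_def)
  have g: "g x \<in> carrier M" if "x \<in> carrier M" for x
    using Bij_imp_funcset[OF B(2)] that by blast
  have "compose (carrier M) f g \<in> automorphisms M"
    using fg g by (simp add: automorphisms_def compose_Bij compose_eq)
  then show "f \<otimes>\<^bsub>BijGroup (carrier M)\<^esub> g \<in> automorphisms M"
    using B by (simp add: BijGroup_def)
qed

lemma group_Aut: "group (Aut M)"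
  unfolding Aut_def
  by (rule subgroup.subgroup_is_group[OF automorphisms_subgroup group_BijGroup])


section \<open>The Dedekind--MacNeille completion\<close>

text \<open>
  The elements are the nonempty, bounded above sets that consist of all lower bounds of their upper
  bounds, ordered by inclusion; \<^term>\<open>x\<close> is identified with \<^term>\<open>under r x\<close>. As is usual for
  cycle-free partial orders, no least or greatest element is adjoined: an adjoined one would join
  any two points by an extra path.
\<close>

definition dm_completion :: "'a rel \<Rightarrow> 'a set set" where
  "dm_completion r = {J. J \<noteq> {} \<and> Above r J \<noteq> {} \<and> Under r (Above r J) = J}"

lemma under_in_dm_completion:
  assumes "partial_order_on A r" "x \<in> A"
  shows "under r x \<in> dm_completion r"
proof -
  have xx: "(x, x) \<in> r" and tr: "trans r"
    using assms by (auto simp: order_on_defs refl_on_def)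
  have "x \<in> Above r (under r x)"
    using xx by (auto simp: Above_def under_def Field_def)
  moreover have "Under r (Above r (under r x)) = under r x"
    using xx \<open>x \<in> Above r (under r x)\<close>
    by (auto simp: Above_def Under_def under_def Field_def)
  moreover have "x \<in> under r x" using xx by (simp add: under_def)
  ultimately show ?thesis unfolding dm_completion_def by blast
qed

section \<open>Connecting sets, paths and cycle-free partial orders\<close>

text \<open>
  Tuples have at least two entries, so that the only path from \<^term>\<open>a\<close> to \<^term>\<open>a\<close> is the
  one-point chain; a one-entry tuple would contribute the empty union as a second path.
\<close>

definition connecting_set :: "'a rel \<Rightarrow> 'a \<Rightarrow> 'a \<Rightarrow> 'a set list \<Rightarrow> bool" where
  "connecting_set r a b c \<longleftrightarrow>
     2 \<le> length c \<and> set c \<subseteq> dm_completion r \<and> hd c = under r a \<and> last c = under r b \<and>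
     (\<forall>i. Suc i < length c \<longrightarrow> c ! i \<subseteq> c ! Suc i \<or> c ! Suc i \<subseteq> c ! i) \<and>
     (\<forall>i. Suc (Suc i) < length c \<longrightarrow>
        c ! i \<subset> c ! Suc i \<and> c ! Suc (Suc i) \<subset> c ! Suc i \<or>
        c ! Suc i \<subset> c ! i \<and> c ! Suc i \<subset> c ! Suc (Suc i))"

text \<open>
  A chain with endpoints \<^term>\<open>c\<close> and \<^term>\<open>d\<close> lies in the interval between them, so the maximal
  such chains are the maximal chains of that interval; either endpoint may be the lower one.
\<close>

definition maxchain_between :: "'a rel \<Rightarrow> 'a set \<Rightarrow> 'a set \<Rightarrow> 'a set set \<Rightarrow> bool" where
  "maxchain_between r c d s \<longleftrightarrow>
     subset.maxchain {J \<in> dm_completion r. c \<subseteq> J \<and> J \<subseteq> d \<or> d \<subseteq> J \<and> J \<subseteq> c} s"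

definition is_path :: "'a rel \<Rightarrow> 'a \<Rightarrow> 'a \<Rightarrow> 'a set set \<Rightarrow> bool" where
  "is_path r a b p \<longleftrightarrow>
     (\<exists>c \<sigma>. connecting_set r a b c \<and>
        (\<forall>k. Suc k < length c \<longrightarrow> maxchain_between r (c ! k) (c ! Suc k) (\<sigma> k)) \<and>
        (\<forall>i j. i < j \<and> Suc j < length c \<and> \<sigma> i \<inter> \<sigma> j \<noteq> {} \<longrightarrow>
           j = Suc i \<and> \<sigma> i \<inter> \<sigma> j = {c ! Suc i}) \<and>
        p = (\<Union>k \<in> {k. Suc k < length c}. \<sigma> k))"

definition CFPO :: "'a coloured_order \<Rightarrow> bool" where
  "CFPO M \<longleftrightarrow> coloured_partial_order M \<and>
     (\<forall>a \<in> carrier M. \<forall>b \<in> carrier M. \<exists>\<^sub>\<le>\<^sub>1 p. is_path (ord_rel M) a b p)"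

definition connected_CFPO :: "'a coloured_order \<Rightarrow> bool" where
  "connected_CFPO M \<longleftrightarrow> CFPO M \<and>
     (\<forall>a \<in> carrier M. \<forall>b \<in> carrier M. \<exists>p. is_path (ord_rel M) a b p)"


section \<open>Alternating chains\<close>

definition Alt :: "int rel" where
  "Alt = {(i, j). i = j \<or> odd i \<and> (j = i - 1 \<or> j = i + 1)}"

definition Alt_omega :: "int rel" where
  "Alt_omega = Restr Alt {0..}"

definition order_embeds :: "'a rel \<Rightarrow> 'b rel \<Rightarrow> bool" where
  "order_embeds r s \<longleftrightarrow>
     (\<exists>f. inj_on f (Field r) \<and> f ` Field r \<subseteq> Field s \<and>
        (\<forall>x \<in> Field r. \<forall>y \<in> Field r. (f x, f y) \<in> s \<longleftrightarrow> (x, y) \<in> r))"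

definition CFPO_omega :: "'a coloured_order \<Rightarrow> bool" where
  "CFPO_omega M \<longleftrightarrow> CFPO M \<and>
     order_embeds Alt_omega (ord_rel M) \<and> \<not> order_embeds Alt (ord_rel M)"


section \<open>Trees and treelike orders\<close>

definition coloured_tree :: "'a coloured_order \<Rightarrow> bool" where
  "coloured_tree T \<longleftrightarrow> coloured_partial_order T \<and>
     (\<forall>x \<in> carrier T. total_on (under (ord_rel T) x) (ord_rel T)) \<and>
     (\<forall>x \<in> carrier T. \<forall>y \<in> carrier T. Under (ord_rel T) {x, y} \<noteq> {})"

text \<open>
  HOL has no quantification over types, so a type has to be fixed for the points of the tree:
  \<^typ>\<open>'a set\<close>, which contains the Dedekind--MacNeille completion.
\<close>

definition treelike :: "'a coloured_order \<Rightarrow> bool" where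
  "treelike M \<longleftrightarrow> (\<exists>T :: 'a set coloured_order. coloured_tree T \<and> Aut M \<cong> Aut T)"

end

theory Submission
  imports Defs
begin

text \<open>
  Rays in the completion, that is, infinite alternating sequences whose consecutive intervals meet
  only in the common turning point, exist from every point because \<open>M\<close> is connected and contains
  \<open>Alt_omega\<close>. Two rays with a common origin that do not agree up to the first turning point could be
  spliced into a two-sided one, hence into a copy of \<open>Alt\<close>, since uniqueness of paths makes the points
  of a zigzag incomparable unless adjacent. So all rays lead to a single end, which every automorphism
  fixes. Put \<open>z\<close> below \<open>x\<close> if \<open>z\<close> lies on the ray from \<open>x\<close>; this makes the completion a tree. Colouring
  its points by whether their ray starts upwards, by membership in \<open>M\<close>, and by the colours of \<open>M\<close> makes
  the original order definable from the tree, so both structures have the same automorphisms.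
\<close>

section \<open>The completion of a cycle-free partial order\<close>

text \<open>Path uniqueness speaks only about end points in \<open>M\<close>, while the turning
  points of rays lie in the completion. It is therefore applied after pushing the two ends of a
  finite zigzag outwards, away from their neighbours, until they are points of \<open>M\<close>. A
  zigzag is required to turn cleanly only at each single turning point; that distant segments are
  disjoint then follows from cycle-freeness. A copy of \<open>Alt_omega\<close> need not turn
  cleanly, as consecutive intervals may overlap; its turning points are moved to joins and meets,
  which the completion provides. The end acts as a root at infinity: going down in the tree means
  going towards it. Turning points alternate between upper and lower, so a descent along which the
  starting direction is constant passes no turning point and is monotone in the original order; this
  is why a single direction colour suffices. The flag \<open>b\<close> in \<open>dle\<close> selects
  inclusion or its dual, so that one statement covers both kinds of turning point.\<close>

definition dle :: "bool \<Rightarrow> 'b set \<Rightarrow> 'b set \<Rightarrow> bool" where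
  "dle b x y \<longleftrightarrow> (if b then x \<subseteq> y else y \<subseteq> x)"

lemma dle_refl [simp]: "dle b x x"
  by (simp add: dle_def)

lemma dle_trans: "dle b x y \<Longrightarrow> dle b y z \<Longrightarrow> dle b x z"
  by (auto simp: dle_def split: if_splits)

lemma dle_antisym: "dle b x y \<Longrightarrow> dle b y x \<Longrightarrow> x = y"
  by (auto simp: dle_def split: if_splits)

lemma dle_Not [simp]: "dle (\<not> b) x y \<longleftrightarrow> dle b y x"
  by (simp add: dle_def)

definition interval :: "'a rel \<Rightarrow> 'a set \<Rightarrow> 'a set \<Rightarrow> 'a set set" where
  "interval r x y = {z \<in> dm_completion r. x \<subseteq> z \<and> z \<subseteq> y \<or> y \<subseteq> z \<and> z \<subseteq> x}"

lemma interval_commute: "interval r x y = interval r y x"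
  by (auto simp: interval_def)

lemma interval_iff: "dle b x y \<Longrightarrow>
    z \<in> interval r x y \<longleftrightarrow> z \<in> dm_completion r \<and> dle b x z \<and> dle b z y"
  by (auto simp: interval_def dle_def split: if_splits)

lemma maxchain_between_interval:
  "maxchain_between r x y s \<longleftrightarrow> subset.maxchain (interval r x y) s"
  by (simp add: maxchain_between_def interval_def)

lemma maxchain_of_chain:
  assumes "subset.chain S S"
  shows "subset.maxchain S S"
  using assms unfolding subset.maxchain_def subset_chain_def by blast

text \<open>Hausdorff's principle is applied to the elements comparable with \<open>x\<close>: a
  maximal chain among them must contain \<open>x\<close>, and every chain extending it stays among
  them.\<close>

lemma maxchain_through:
  assumes "x \<in> S"
  obtains C where "subset.maxchain S C" "x \<in> C"
proof -
  let ?B = "{y \<in> S. x \<subseteq> y \<or> y \<subseteq> x}"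
  obtain C where C: "subset.maxchain ?B C" using subset.Hausdorff by blast
  then have ch: "subset.chain ?B C" by (simp add: subset.maxchain_def)
  have x: "x \<in> C"
  proof (rule ccontr)
    assume "x \<notin> C"
    moreover have "subset.chain ?B (insert x C)"
      using ch assms unfolding subset_chain_def by auto
    ultimately show False using C unfolding subset.maxchain_def by blast
  qed
  have "subset.maxchain S C"
    unfolding subset.maxchain_def
  proof (intro conjI notI)
    show "subset.chain S C" using ch unfolding subset_chain_def by auto
    assume "\<exists>D. subset.chain S D \<and> C \<subset> D"
    then obtain D where D: "subset.chain S D" "C \<subset> D" by blast
    then have "subset.chain ?B D"
      using x unfolding subset_chain_def by blast
    then show False using C D unfolding subset.maxchain_def by blast
  qed
  then show ?thesis using x that by blast
qed

section \<open>Meets, joins, linear intervals and turning points in the completion\<close>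

locale cycle_free =
  fixes A :: "'a set" and r :: "'a rel"
  assumes po: "partial_order_on A r"
    and path_unique: "\<lbrakk>a \<in> A; b \<in> A; is_path r a b p; is_path r a b q\<rbrakk> \<Longrightarrow> p = q"
begin

abbreviation "X \<equiv> dm_completion r"

lemma r_refl: "a \<in> A \<Longrightarrow> (a, a) \<in> r"
  using po by (auto simp: order_on_defs refl_on_def)

lemma r_in: "(a, b) \<in> r \<Longrightarrow> a \<in> A \<and> b \<in> A"
  using po by (auto simp: order_on_defs)

lemma r_trans: "(a, b) \<in> r \<Longrightarrow> (b, c) \<in> r \<Longrightarrow> (a, c) \<in> r"
  using po by (auto simp: order_on_defs dest: transD)

lemma r_antisym: "(a, b) \<in> r \<Longrightarrow> (b, a) \<in> r \<Longrightarrow> a = b"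
  using po by (auto simp: order_on_defs dest: antisymD)

lemma Field_r: "Field r = A"
  using r_refl r_in by (auto simp: Field_def)

lemma under_X: "a \<in> A \<Longrightarrow> under r a \<in> X"
  using under_in_dm_completion[OF po] .

lemma under_subset_iff: "a \<in> A \<Longrightarrow> under r a \<subseteq> under r b \<longleftrightarrow> (a, b) \<in> r"
  using r_refl[of a] r_trans[of _ a b] by (auto simp: under_def)

lemma under_inject: "a \<in> A \<Longrightarrow> b \<in> A \<Longrightarrow> under r a = under r b \<longleftrightarrow> a = b"
  by (metis under_subset_iff r_antisym order_refl)

lemma X_subset: "J \<in> X \<Longrightarrow> J \<subseteq> A"
  using Field_r by (auto simp: dm_completion_def Under_def)

lemma X_down:
  assumes "J \<in> X" "a \<in> J" "(x, a) \<in> r"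
  shows "x \<in> J"
proof -
  have J: "Under r (Above r J) = J" using assms by (simp add: dm_completion_def)
  have "(x, u) \<in> r" if "u \<in> Above r J" for u
    using that assms r_trans[of x a u] by (simp add: Above_def)
  then have "x \<in> Under r (Above r J)" using r_in[OF assms(3)] by (simp add: Under_def Field_r)
  then show ?thesis using J by simp
qed

lemma under_subset_X_iff:
  assumes "J \<in> X" "a \<in> A"
  shows "under r a \<subseteq> J \<longleftrightarrow> a \<in> J"
  using X_down[OF assms(1)] r_refl[OF assms(2)] by (auto simp: under_def)

lemma ex_under_dle:
  assumes "J \<in> X"
  shows "\<exists>a\<in>A. dle b (under r a) J"
proof (cases b)
  case True
  obtain a where "a \<in> J" using assms by (auto simp: dm_completion_def)
  then show ?thesis using True X_subset[OF assms] X_down[OF assms] by (auto simp: dle_def under_def)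
next
  case False
  obtain a where "a \<in> Above r J" using assms by (auto simp: dm_completion_def)
  then show ?thesis using False Field_r by (auto simp: dle_def Above_def under_def)
qed

lemma X_closed: "J \<in> X \<Longrightarrow> Under r (Above r J) = J"
  by (simp add: dm_completion_def)

lemma Above_antimono: "J \<subseteq> K \<Longrightarrow> Above r K \<subseteq> Above r J"
  by (auto simp: Above_def)

lemma Under_antimono: "J \<subseteq> K \<Longrightarrow> Under r K \<subseteq> Under r J"
  by (auto simp: Under_def)

lemma subset_Under_Above: "J \<subseteq> A \<Longrightarrow> J \<subseteq> Under r (Above r J)"
  by (auto simp: Under_def Above_def Field_r)

text \<open>For \<open>b\<close> true the meet is the intersection, for \<open>b\<close> false it is
  the closure of the union. No extreme elements are adjoined to the completion, so the common bound
  \<open>L\<close> is what makes the intersection nonempty, respectively the union bounded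
  above.\<close>

lemma ex_inf:
  assumes X: "J \<in> X" "K \<in> X" "L \<in> X" and L: "dle b L J" "dle b L K"
  shows "\<exists>m\<in>X. dle b m J \<and> dle b m K \<and> (\<forall>z\<in>X. dle b z J \<longrightarrow> dle b z K \<longrightarrow> dle b z m)"
proof (cases b)
  case True
  have "L \<subseteq> J \<inter> K" using True L by (simp add: dle_def)
  moreover have "L \<noteq> {}" "Above r J \<noteq> {}" using X by (simp_all add: dm_completion_def)
  ultimately have ne: "J \<inter> K \<noteq> {}" "Above r (J \<inter> K) \<noteq> {}"
    using Above_antimono[of "J \<inter> K" J] by blast+
  have "Under r (Above r (J \<inter> K)) = J \<inter> K"
  proof
    have "Under r (Above r (J \<inter> K)) \<subseteq> Under r (Above r J)"
      "Under r (Above r (J \<inter> K)) \<subseteq> Under r (Above r K)"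
      by (intro Under_antimono Above_antimono inf_le1 inf_le2)+
    then show "Under r (Above r (J \<inter> K)) \<subseteq> J \<inter> K" using X X_closed by simp
    show "J \<inter> K \<subseteq> Under r (Above r (J \<inter> K))"
      using X_subset[OF X(1)] by (intro subset_Under_Above) blast
  qed
  then have "J \<inter> K \<in> X" using ne by (simp add: dm_completion_def)
  then show ?thesis using True by (auto simp: dle_def)
next
  case False
  let ?U = "Above r (J \<union> K)" let ?m = "Under r ?U"
  have "J \<union> K \<subseteq> L" using False L by (simp add: dle_def)
  moreover have "Above r L \<noteq> {}" "J \<noteq> {}" using X by (simp_all add: dm_completion_def)
  ultimately have U: "?U \<noteq> {}" using Above_antimono[of "J \<union> K" L] by blast
  have JK: "J \<union> K \<subseteq> ?m"
    using X_subset[OF X(1)] X_subset[OF X(2)] by (intro subset_Under_Above) blast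
  have "Above r ?m = ?U"
  proof
    show "Above r ?m \<subseteq> ?U" using JK by (rule Above_antimono)
    show "?U \<subseteq> Above r ?m" by (auto simp: Above_def Under_def)
  qed
  then have m: "?m \<in> X" using U JK \<open>J \<noteq> {}\<close> by (auto simp: dm_completion_def)
  have least: "?m \<subseteq> z" if "z \<in> X" "J \<subseteq> z" "K \<subseteq> z" for z
  proof -
    have "?m \<subseteq> Under r (Above r z)" using that by (intro Under_antimono Above_antimono) blast
    then show ?thesis using X_closed[OF that(1)] by simp
  qed
  show ?thesis by (rule bexI[OF _ m]) (use JK least False in \<open>simp add: dle_def\<close>)
qed

lemma path_of_maxchain:
  assumes "a \<in> A" "b \<in> A" "(a, b) \<in> r" "subset.maxchain (interval r (under r a) (under r b)) C"
  shows "is_path r a b C"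
  unfolding is_path_def
proof (intro exI conjI)
  let ?c = "[under r a, under r b]"
  show "connecting_set r a b ?c"
    using assms under_X under_subset_iff by (auto simp: connecting_set_def)
  show "\<forall>k. Suc k < length ?c \<longrightarrow> maxchain_between r (?c ! k) (?c ! Suc k) ((\<lambda>_. C) k)"
    using assms by (auto simp: maxchain_between_interval)
  show "\<forall>i j. i < j \<and> Suc j < length ?c \<and> (\<lambda>_. C) i \<inter> (\<lambda>_. C) j \<noteq> {} \<longrightarrow>
           j = Suc i \<and> (\<lambda>_. C) i \<inter> (\<lambda>_. C) j = {?c ! Suc i}"
    by simp
  show "C = (\<Union>k \<in> {k. Suc k < length ?c}. (\<lambda>_. C) k)" by auto
qed

text \<open>A maximal chain between comparable points of \<open>A\<close> is by itself a path, so by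
  uniqueness there is only one; the maximal chains through \<open>x\<close> and through
  \<open>y\<close> coincide.\<close>

lemma interval_chain_under:
  assumes "a \<in> A" "b \<in> A" "(a, b) \<in> r"
    and x: "x \<in> interval r (under r a) (under r b)" and y: "y \<in> interval r (under r a) (under r b)"
  shows "x \<subseteq> y \<or> y \<subseteq> x"
proof -
  obtain C where C: "subset.maxchain (interval r (under r a) (under r b)) C" "x \<in> C"
    using maxchain_through[OF x] .
  obtain D where D: "subset.maxchain (interval r (under r a) (under r b)) D" "y \<in> D"
    using maxchain_through[OF y] .
  have "C = D"
    using path_unique[OF assms(1,2) path_of_maxchain[OF assms(1-3) C(1)]
      path_of_maxchain[OF assms(1-3) D(1)]] .
  then show ?thesis using C D unfolding subset.maxchain_def subset_chain_def by blast
qed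

text \<open>The bounds are widened to points of \<open>A\<close>, where linearity of the interval is
  already known.\<close>

lemma dle_chain:
  assumes "J \<in> X" "K \<in> X" "x \<in> X" "y \<in> X"
    and "dle b J x" "dle b x K" "dle b J y" "dle b y K"
  shows "dle b x y \<or> dle b y x"
proof -
  have *: "u \<subseteq> v \<or> v \<subseteq> u"
    if "P \<in> X" "Q \<in> X" "u \<in> X" "v \<in> X" "P \<subseteq> u" "u \<subseteq> Q" "P \<subseteq> v" "v \<subseteq> Q" for P Q u v
  proof -
    obtain p where p: "p \<in> A" "under r p \<subseteq> P"
      using ex_under_dle[OF \<open>P \<in> X\<close>, of True] by (auto simp: dle_def)
    obtain q where q: "q \<in> A" "Q \<subseteq> under r q"
      using ex_under_dle[OF \<open>Q \<in> X\<close>, of False] by (auto simp: dle_def)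
    have u: "under r p \<subseteq> u" "u \<subseteq> under r q" and v: "under r p \<subseteq> v" "v \<subseteq> under r q"
      using p q that by (meson order_trans)+
    then have "(p, q) \<in> r" using under_subset_iff[OF p(1), of q] by (meson order_trans)
    then show ?thesis
      using p q u v that by (intro interval_chain_under[of p q]) (simp_all add: interval_def)
  qed
  show ?thesis
  proof (cases b)
    case True then show ?thesis using *[OF assms(1-4)] assms(5-8) by (simp add: dle_def)
  next
    case False then show ?thesis using *[OF assms(2,1,3,4)] assms(5-8) by (auto simp: dle_def)
  qed
qed

lemma chain_interval:
  assumes "x \<in> X" "y \<in> X" shows "subset.chain (interval r x y) (interval r x y)"
  unfolding subset_chain_def
proof (intro conjI ballI)
  fix u v assume uv: "u \<in> interval r x y" "v \<in> interval r x y"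
  then have "dle True x y \<or> dle False x y" by (auto simp: interval_def dle_def)
  then obtain b where b: "dle b x y" by blast
  have "dle b u v \<or> dle b v u"
    using uv dle_chain[OF assms, of u v b] unfolding interval_iff[OF b] by blast
  then show "u \<subseteq> v \<or> v \<subseteq> u" by (auto simp: dle_def split: if_splits)
qed simp

text \<open>The segments from \<open>u\<close> to \<open>v\<close> and from \<open>v\<close> to
  \<open>w\<close> meet only in the turning point \<open>v\<close>. As bounded meets exist in the
  completion, this makes \<open>v\<close> the meet of \<open>u\<close> and \<open>w\<close> in
  direction \<open>b\<close>, distinct from both.\<close>

definition tight :: "bool \<Rightarrow> 'a set \<Rightarrow> 'a set \<Rightarrow> 'a set \<Rightarrow> bool" where
  "tight b u v w \<longleftrightarrow> dle b v u \<and> dle b v w \<and> v \<noteq> u \<and> v \<noteq> w \<and>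
     (\<forall>z\<in>X. dle b v z \<longrightarrow> dle b z u \<longrightarrow> dle b z w \<longrightarrow> z = v)"

lemma tight_dle: "tight b u v w \<Longrightarrow> dle b v u \<and> dle b v w \<and> v \<noteq> u \<and> v \<noteq> w"
  by (simp add: tight_def)

lemma tight_eq: "\<lbrakk>tight b u v w; z \<in> X; dle b v z; dle b z u; dle b z w\<rbrakk> \<Longrightarrow> z = v"
  by (simp add: tight_def)

lemma tight_commute: "tight b u v w \<longleftrightarrow> tight b w v u"
  by (auto simp: tight_def)

text \<open>The interval from \<open>v\<close> to \<open>u'\<close> is a chain, so a common bound
  \<open>z\<close> is comparable with \<open>u\<close>. If it lay beyond \<open>u\<close>, then
  \<open>u\<close> would be below \<open>w\<close> in direction \<open>b\<close>, and tightness
  would give \<open>u = v\<close>.\<close>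

lemma tight_extend:
  assumes t: "tight b u v w" and X: "u \<in> X" "v \<in> X" "u' \<in> X" and u: "dle b u u'"
  shows "tight b u' v w"
proof -
  have vu: "dle b v u'" using tight_dle[OF t] dle_trans[OF _ u] by simp
  have "z = v" if z: "z \<in> X" "dle b v z" "dle b z u'" "dle b z w" for z
  proof -
    consider "dle b z u" | "dle b u z"
      using dle_chain[of v u' z u b] z X u vu tight_dle[OF t] by blast
    then show ?thesis
    proof cases
      case 1 then show ?thesis using tight_eq[OF t] z by simp
    next
      case 2
      then have "dle b u w" using z(4) by (rule dle_trans)
      then have "u = v" using tight_eq[OF t, of u] X tight_dle[OF t] by simp
      then show ?thesis using tight_dle[OF t] by simp
    qed
  qed
  moreover have "v \<noteq> u'" using tight_dle[OF t] u dle_antisym[of b v u] by auto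
  ultimately show ?thesis using tight_dle[OF t] vu by (simp add: tight_def)
qed

lemma tight_shrink:
  assumes "tight b u v w" "dle b v u'" "dle b u' u" "v \<noteq> u'"
  shows "tight b u' v w"
  using assms dle_trans[OF _ \<open>dle b u' u\<close>] by (simp add: tight_def)

lemma tight_incomparable:
  assumes "tight b u v w" "u \<in> X" "w \<in> X"
  shows "\<not> dle c u w"
proof
  assume "dle c u w"
  then have "dle b u w \<or> dle b w u" by (auto simp: dle_def split: if_splits)
  then show False
    using tight_dle[OF assms(1)] tight_eq[OF assms(1,2)] tight_eq[OF assms(1,3)] by auto
qed

lemma tight_interval_Int:
  assumes "tight b u v w" "v \<in> X"
  shows "interval r u v \<inter> interval r v w = {v}"
proof -
  note d = tight_dle[OF assms(1)]
  have "z = v" if "z \<in> interval r v u" "z \<in> interval r v w" for z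
    using that d tight_eq[OF assms(1), of z] by (simp add: interval_iff[of b])
  moreover have "v \<in> interval r v u" "v \<in> interval r v w"
    using d assms(2) by (simp_all add: interval_iff[of b])
  ultimately show ?thesis unfolding interval_commute[of r u v] by blast
qed

text \<open>
  In a zigzag \<open>c\<close> the entry \<open>c i\<close> is a lower turning point if \<open>node b i\<close> holds and an upper one
  otherwise. The index set \<open>W\<close> is meant to be an integer interval, possibly unbounded.
\<close>

definition node :: "bool \<Rightarrow> int \<Rightarrow> bool" where
  "node b i \<longleftrightarrow> b = even i"

lemma node_Suc: "node b (i + 1) \<longleftrightarrow> \<not> node b i" "node b (1 + i) \<longleftrightarrow> \<not> node b i"
   "node b (i - 1) \<longleftrightarrow> \<not> node b i"
  by (auto simp: node_def)

lemma node_0 [simp]: "node b 0 = b"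
  by (simp add: node_def)

lemma node_minus [simp]: "node b (- i) = node b i"
  by (simp add: node_def)

lemma node_add: "node b (i + k) = node (node b k) i"
  by (auto simp: node_def)

section \<open>Zigzags and their acyclicity\<close>

definition zigzag :: "bool \<Rightarrow> int set \<Rightarrow> (int \<Rightarrow> 'a set) \<Rightarrow> bool" where
  "zigzag b W c \<longleftrightarrow> (\<forall>i\<in>W. c i \<in> X) \<and>
     (\<forall>i. i \<in> W \<longrightarrow> i + 1 \<in> W \<longrightarrow> dle (node b i) (c i) (c (i + 1)) \<and> c i \<noteq> c (i + 1)) \<and>
     (\<forall>i. i - 1 \<in> W \<longrightarrow> i \<in> W \<longrightarrow> i + 1 \<in> W \<longrightarrow> tight (node b i) (c (i - 1)) (c i) (c (i + 1)))"

lemma zigzagI: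
  assumes "\<And>i. i \<in> W \<Longrightarrow> c i \<in> X"
    and "\<And>i. i \<in> W \<Longrightarrow> i + 1 \<in> W \<Longrightarrow> dle (node b i) (c i) (c (i + 1)) \<and> c i \<noteq> c (i + 1)"
    and "\<And>i. i - 1 \<in> W \<Longrightarrow> i \<in> W \<Longrightarrow> i + 1 \<in> W \<Longrightarrow> tight (node b i) (c (i - 1)) (c i) (c (i + 1))"
  shows "zigzag b W c"
  using assms by (simp add: zigzag_def)

lemma zigzag_X: "zigzag b W c \<Longrightarrow> i \<in> W \<Longrightarrow> c i \<in> X"
  by (simp add: zigzag_def)

lemma zigzag_edge:
  "zigzag b W c \<Longrightarrow> i \<in> W \<Longrightarrow> i + 1 \<in> W \<Longrightarrow> dle (node b i) (c i) (c (i + 1)) \<and> c i \<noteq> c (i + 1)"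
  by (simp add: zigzag_def)

lemma zigzag_tight:
  "zigzag b W c \<Longrightarrow> i - 1 \<in> W \<Longrightarrow> i \<in> W \<Longrightarrow> i + 1 \<in> W
    \<Longrightarrow> tight (node b i) (c (i - 1)) (c i) (c (i + 1))"
  by (simp add: zigzag_def)

lemma zigzag_mono: "zigzag b W c \<Longrightarrow> V \<subseteq> W \<Longrightarrow> zigzag b V c"
  by (rule zigzagI) (use zigzag_X zigzag_edge zigzag_tight in blast)+

lemma zigzag_shift:
  assumes "zigzag b W c"
  shows "zigzag (node b k) {i. i + k \<in> W} (\<lambda>i. c (i + k))"
proof (rule zigzagI; simp)
  fix i assume "i + k \<in> W"
  then show "c (i + k) \<in> X" using assms zigzag_X by blast
next
  fix i assume "i + k \<in> W" "i + 1 + k \<in> W"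
  then show "dle (node (node b k) i) (c (i + k)) (c (i + 1 + k)) \<and> c (i + k) \<noteq> c (i + 1 + k)"
    using zigzag_edge[OF assms, of "i + k"] by (simp add: node_add algebra_simps)
next
  fix i assume "i - 1 + k \<in> W" "i + k \<in> W" "i + 1 + k \<in> W"
  then show "tight (node (node b k) i) (c (i - 1 + k)) (c (i + k)) (c (i + 1 + k))"
    using zigzag_tight[OF assms, of "i + k"] by (simp add: node_add algebra_simps)
qed

text \<open>The new end lies on the far side of \<open>c p\<close> from its neighbour, so the last
  edge only grows and tightness at the neighbour survives by \<open>tight_extend\<close>. In this
  way ends are brought into \<open>A\<close>.\<close>

lemma zigzag_replace_end:
  assumes z: "zigzag b W c" and p: "p \<in> W" "p - 1 \<notin> W \<or> p + 1 \<notin> W"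
    and x: "x \<in> X" "dle (node b p) x (c p)"
  shows "zigzag b W (c(p := x))"
proof (rule zigzagI)
  fix i assume "i \<in> W" then show "(c(p := x)) i \<in> X" using zigzag_X[OF z] x by auto
next
  fix i assume i: "i \<in> W" "i + 1 \<in> W"
  have e: "dle (node b i) (c i) (c (i + 1))" "c i \<noteq> c (i + 1)" using zigzag_edge[OF z i] by auto
  show "dle (node b i) ((c(p := x)) i) ((c(p := x)) (i + 1)) \<and> (c(p := x)) i \<noteq> (c(p := x)) (i + 1)"
  proof (cases "i = p")
    case True
    then have "dle (node b i) x (c (i + 1))" "x \<noteq> c (i + 1)"
      using e x dle_trans[of "node b i" x "c i"] dle_antisym[of "node b i" x "c i"] by auto
    then show ?thesis using True by simp
  next
    case False
    show ?thesis
    proof (cases "i + 1 = p")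
      case True
      then have "dle (node b i) (c p) x" using x node_Suc(1)[of b i] by auto
      then have "dle (node b i) (c i) x" "c i \<noteq> x"
        using True e dle_trans[of "node b i" "c i" "c p"] dle_antisym[of "node b i" "c i" "c p"] by auto
      then show ?thesis using True False by simp
    qed (use False e in auto)
  qed
next
  fix i assume i: "i - 1 \<in> W" "i \<in> W" "i + 1 \<in> W"
  have t: "tight (node b i) (c (i - 1)) (c i) (c (i + 1))" using zigzag_tight[OF z i] .
  have "i \<noteq> p" using p i by auto
  consider "i - 1 = p" | "i + 1 = p" | "i - 1 \<noteq> p" "i + 1 \<noteq> p" by blast
  then show "tight (node b i) ((c(p := x)) (i - 1)) ((c(p := x)) i) ((c(p := x)) (i + 1))"
  proof cases
    case 1
    have "dle (node b i) (c (i - 1)) x" using x 1 node_Suc(3)[of b i] by auto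
    then have "tight (node b i) x (c i) (c (i + 1))"
      using tight_extend[OF t] zigzag_X[OF z] i x by blast
    then show ?thesis using 1 \<open>i \<noteq> p\<close> by auto
  next
    case 2
    have "dle (node b i) (c (i + 1)) x" using x 2 node_Suc(1)[of b i] by auto
    then have "tight (node b i) x (c i) (c (i - 1))"
      using tight_extend t zigzag_X[OF z] i x by (meson tight_commute)
    then show ?thesis using 2 \<open>i \<noteq> p\<close> tight_commute by auto
  next
    case 3 then show ?thesis using t \<open>i \<noteq> p\<close> by auto
  qed
qed

text \<open>If the ends were comparable, the union of the segments and the single interval between
  the ends would both be paths, hence equal; then the first and third points would lie in one chain,
  against tightness. Disjointness of distant segments is a hypothesis because its own proof is an
  induction that uses this lemma on shorter zigzags.\<close>

lemma zigzag_ends_incomparable: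
  assumes z: "zigzag b {lo..hi} c" and len: "lo + 2 \<le> hi"
    and a: "a \<in> A" "c lo = under r a" "a' \<in> A" "c hi = under r a'"
    and disj: "\<And>i j. \<lbrakk>lo \<le> i; i + 1 < j; j < hi\<rbrakk>
      \<Longrightarrow> interval r (c i) (c (i + 1)) \<inter> interval r (c j) (c (j + 1)) = {}"
  shows "\<not> dle d (under r a) (under r a')"
proof
  assume d: "dle d (under r a) (under r a')"
  define n where "n = nat (hi - lo)"
  have n: "2 \<le> n" "hi = lo + int n" using len by (auto simp: n_def)
  let ?q = "\<lambda>k. c (lo + int k)"
  define cs where "cs = map ?q [0..<Suc n]"
  have len_cs: "length cs = Suc n" by (simp add: cs_def)
  have nth: "cs ! k = ?q k" if "k \<le> n" for k using that by (simp add: cs_def del: upt_Suc)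
  have ne: "cs \<noteq> []" by (simp add: cs_def)
  have qX: "?q k \<in> X" if "k \<le> n" for k using zigzag_X[OF z, of "lo + int k"] n that by auto
  have edge: "dle (node b (lo + int k)) (?q k) (?q (Suc k)) \<and> ?q k \<noteq> ?q (Suc k)" if "k < n" for k
    using zigzag_edge[OF z, of "lo + int k"] that n by (auto simp: algebra_simps)
  have tight: "tight (node b (lo + int (Suc k))) (?q k) (?q (Suc k)) (?q (Suc (Suc k)))" if "Suc k < n" for k
    using zigzag_tight[OF z, of "lo + int (Suc k)"] that n by (auto simp: algebra_simps)
  define s where "s k = interval r (?q k) (?q (Suc k))" for k
  have conn: "connecting_set r a a' cs"
    unfolding connecting_set_def
  proof (intro conjI allI impI)
    show "2 \<le> length cs" using n len_cs by simp
    show "set cs \<subseteq> X" using qX by (auto simp: cs_def simp del: upt_Suc)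
    show "hd cs = under r a" using a nth[of 0] ne by (simp add: hd_conv_nth)
    show "last cs = under r a'" using a nth[of n] n ne len_cs by (simp add: last_conv_nth)
    fix i
    { assume "Suc i < length cs"
      then show "cs ! i \<subseteq> cs ! Suc i \<or> cs ! Suc i \<subseteq> cs ! i"
        using edge[of i] nth[of i] nth[of "Suc i"] len_cs by (simp add: dle_def split: if_splits) }
    { assume "Suc (Suc i) < length cs"
      then show "cs ! i \<subset> cs ! Suc i \<and> cs ! Suc (Suc i) \<subset> cs ! Suc i \<or>
          cs ! Suc i \<subset> cs ! i \<and> cs ! Suc i \<subset> cs ! Suc (Suc i)"
        using tight_dle[OF tight[of i]] nth[of i] nth[of "Suc i"] nth[of "Suc (Suc i)"] len_cs
        by (simp add: dle_def psubset_eq split: if_splits) metis }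
  qed
  have path1: "is_path r a a' (\<Union>k \<in> {k. Suc k < length cs}. s k)"
    unfolding is_path_def
  proof (intro exI conjI allI impI)
    show "connecting_set r a a' cs" by (rule conn)
    fix k assume "Suc k < length cs"
    then show "maxchain_between r (cs ! k) (cs ! Suc k) (s k)"
      using nth[of k] nth[of "Suc k"] qX[of k] qX[of "Suc k"] len_cs
      by (auto simp: maxchain_between_interval s_def intro!: maxchain_of_chain chain_interval)
  next
    fix i j assume ij: "i < j \<and> Suc j < length cs \<and> s i \<inter> s j \<noteq> {}"
    show j: "j = Suc i"
    proof (rule ccontr)
      assume "j \<noteq> Suc i"
      then have "s i \<inter> s j = {}"
        using disj[of "lo + int i" "lo + int j"] ij n len_cs by (auto simp: s_def algebra_simps)
      then show False using ij by simp
    qed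
    show "s i \<inter> s j = {cs ! Suc i}"
      using tight_interval_Int[OF tight[of i]] qX[of "Suc i"] ij nth[of "Suc i"] len_cs
      unfolding s_def j by auto
  qed (rule refl)
  have path2: "is_path r a a' (interval r (under r a) (under r a'))"
  proof -
    have conn2: "connecting_set r a a' [under r a, under r a']"
      using d a under_X by (auto simp: connecting_set_def dle_def split: if_splits)
    have "maxchain_between r (under r a) (under r a') (interval r (under r a) (under r a'))"
      using a under_X by (auto simp: maxchain_between_interval intro!: maxchain_of_chain chain_interval)
    then show ?thesis
      unfolding is_path_def
      by (intro exI[of _ "[under r a, under r a']"] exI[of _ "\<lambda>_. interval r (under r a) (under r a')"] conjI conn2)
        auto
  qed
  have eq: "(\<Union>k \<in> {k. Suc k < length cs}. s k) = interval r (under r a) (under r a')"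
    using path_unique[OF a(1,3) path1 path2] .
  have "x \<in> interval r x y" "y \<in> interval r x y" if "x \<in> X" "y \<in> X" "dle d x y" for x y d
    using that by (simp_all add: interval_iff[OF that(3)])
  then have "?q 0 \<in> s 0" "?q 2 \<in> s 1"
    using n qX[of 0] qX[of 1] qX[of 2] edge[of 0] edge[of 1] by (auto simp: s_def numeral_2_eq_2)
  then have "?q 0 \<in> interval r (under r a) (under r a')" "?q 2 \<in> interval r (under r a) (under r a')"
    using n len_cs unfolding eq[symmetric] by force+
  then have "dle True (?q 0) (?q 2) \<or> dle False (?q 0) (?q 2)"
    using chain_interval[of "under r a" "under r a'"] a under_X by (auto simp: subset_chain_def dle_def)
  then show False
    using tight_incomparable[OF tight[of 0]] qX[of 0] qX[of 2] n by (auto simp: numeral_2_eq_2)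
qed

text \<open>In a counterexample of minimal length only the first and the last segment can meet,
  since any other pair lies in a shorter zigzag. The induction hypothesis also supplies the
  disjointness that \<open>zigzag_ends_incomparable\<close> asks for.\<close>

lemma zigzag_acyclic:
  assumes "zigzag b {lo..hi} c" "lo \<le> i" "i + 1 < j" "j < hi"
  shows "interval r (c i) (c (i + 1)) \<inter> interval r (c j) (c (j + 1)) = {}"
  using assms
proof (induction "nat (hi - lo)" arbitrary: lo hi c i j rule: less_induct)
  case less
  note zig = less.prems(1)
  have disj: "interval r (e k) (e (k + 1)) \<inter> interval r (e l) (e (l + 1)) = {}"
    if "zigzag b {lo'..hi'} e" "hi' - lo' < hi - lo" "lo' \<le> k" "k + 1 < l" "l < hi'" for e lo' hi' k l
    using less.hyps[OF _ that(1,3-5)] that by simp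
  show ?case
  proof (cases "i = lo \<and> j = hi - 1")
    case False
    show ?thesis
      by (rule disj[of i "j + 1"])
        (use False less.prems in \<open>auto intro: zigzag_mono[OF zig]\<close>)
  next
    case True
    then have n: "lo + 3 \<le> hi" using less.prems by auto
    define s where "s = node b lo"
    have X: "c k \<in> X" if "lo \<le> k" "k \<le> hi" for k using zigzag_X[OF zig] that by auto
    have e0: "dle s (c lo) (c (lo + 1))" using zigzag_edge[OF zig, of lo] n by (auto simp: s_def)
    have eh: "dle (node b (hi - 1)) (c (hi - 1)) (c hi)" using zigzag_edge[OF zig, of "hi - 1"] n by auto
    show ?thesis
    proof (rule ccontr)
      assume "\<not> ?thesis"
      then obtain z where "z \<in> interval r (c lo) (c (lo + 1))" "z \<in> interval r (c (hi - 1)) (c hi)"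
        using True by auto
      then have zX: "z \<in> X" and z0: "dle s (c lo) z" "dle s z (c (lo + 1))"
        and zh: "dle (node b (hi - 1)) (c (hi - 1)) z" "dle (node b (hi - 1)) z (c hi)"
        using e0 eh by (auto simp: interval_iff)
      \<comment> \<open>\<open>z\<close> makes two points of the zigzag comparable; pushing both outwards into \<open>A\<close> leaves a
        zigzag with fewer segments, to which the induction hypothesis applies.\<close>
      have shortcut: False if q: "q \<le> hi" "lo + 3 \<le> q" "node b q = s" "dle s (c q) (c (lo + 1))" for q
      proof -
        have n1: "node b (lo + 1) = (\<not> s)" by (simp add: s_def node_Suc)
        obtain a where a: "a \<in> A" "dle (\<not> s) (under r a) (c (lo + 1))"
          using ex_under_dle[OF X[of "lo + 1"], of "\<not> s"] n by auto
        obtain a' where a': "a' \<in> A" "dle s (under r a') (c q)"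
          using ex_under_dle[OF X[of q], of s] q by auto
        define e where "e = c(lo + 1 := under r a, q := under r a')"
        have "zigzag b {lo + 1..q} c" using zig q n by (auto intro: zigzag_mono)
        then have "zigzag b {lo + 1..q} (c(lo + 1 := under r a))"
          by (rule zigzag_replace_end) (use q a n1 under_X in auto)
        then have ze: "zigzag b {lo + 1..q} e"
          unfolding e_def by (rule zigzag_replace_end) (use q a' under_X in auto)
        have "\<not> dle (\<not> s) (under r a) (under r a')"
        proof (rule zigzag_ends_incomparable[OF ze])
          show "interval r (e i) (e (i + 1)) \<inter> interval r (e j) (e (j + 1)) = {}"
            if "lo + 1 \<le> i" "i + 1 < j" "j < q" for i j
            using disj[OF ze _ that] q by auto
        qed (use q a a' in \<open>auto simp: e_def\<close>)
        moreover have "dle s (under r a') (under r a)"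
          using dle_trans[OF dle_trans[OF a'(2) q(4)]] a(2) by simp
        ultimately show False by simp
      qed
      show False
      proof (cases "node b (hi - 1) = s")
        case False
        then have "node b hi = s" using node_Suc(3)[of b hi] by auto
        moreover from this have "dle s (c hi) z" using zh node_Suc(3)[of b hi] by auto
        ultimately show False using shortcut[of hi] n dle_trans[OF _ z0(2)] by blast
      next
        case True
        show False
        proof (cases "hi = lo + 3")
          case False
          have "dle s (c (hi - 1)) (c (lo + 1))"
            using zh(1) unfolding True by (rule dle_trans[OF _ z0(2)])
          then show False using shortcut[OF _ _ True] False n by linarith
        next
          \<comment> \<open>With three segments the shortcut would compare the neighbours
            \<open>c (lo + 2)\<close> and \<open>c (lo + 1)\<close>, which is no contradiction.
            Instead tightness at \<open>lo + 2\<close> forces \<open>z = c (lo + 2)\<close>, which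
            makes \<open>c lo\<close> and \<open>c (lo + 2)\<close> comparable, against tightness at
            \<open>lo + 1\<close>.\<close>
          case hi: True
          have t1: "tight (\<not> s) (c lo) (c (lo + 1)) (c (lo + 2))"
            using zigzag_tight[OF zig, of "lo + 1"] hi by (simp add: s_def node_Suc add.commute)
          have t2: "tight s (c (lo + 1)) (c (lo + 2)) (c (lo + 3))"
            using zigzag_tight[OF zig, of "lo + 2"] hi True by (simp add: add.commute)
          have "z = c (lo + 2)" using tight_eq[OF t2 zX] z0 zh True hi by (simp add: add.commute)
          then have "dle s (c lo) (c (lo + 2))" using z0 by simp
          then show False using tight_incomparable[OF t1] X[of lo] X[of "lo + 2"] hi by auto
        qed
      qed
    qed
  qed
qed

end

section \<open>Rays\<close>

context cycle_free
begin

section \<open>Two-sided zigzags yield the alternating chain\<close>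

lemma zigzag_incomparable:
  assumes z: "zigzag b W c" and W: "{i..j} \<subseteq> W" and ij: "i + 2 \<le> j"
    and a: "a \<in> A" "dle (node b i) (under r a) (c i)"
    and a': "a' \<in> A" "dle (node b j) (under r a') (c j)"
  shows "\<not> dle d (under r a) (under r a')"
proof -
  have "zigzag b {i..j} (c(i := under r a))"
    by (rule zigzag_replace_end[OF zigzag_mono[OF z W]]) (use ij a under_X in auto)
  then have e: "zigzag b {i..j} (c(i := under r a, j := under r a'))"
    by (rule zigzag_replace_end) (use ij a' under_X in auto)
  show ?thesis
    by (rule zigzag_ends_incomparable[OF e ij a(1) _ a'(1) _ zigzag_acyclic[OF e]]) (use ij in simp_all)
qed

text \<open>A point \<open>f i\<close> of \<open>A\<close> is picked beyond each \<open>c i\<close>.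
  Moving outwards keeps the comparisons between neighbours, and \<open>zigzag_incomparable\<close>
  excludes all others. The flag \<open>False\<close> makes the odd indices the lower points, as in
  \<open>Alt\<close>.\<close>

lemma zigzag_UNIV_embeds_Alt':
  assumes z: "zigzag False UNIV c"
  shows "order_embeds Alt r"
proof -
  have node: "node False i = odd i" for i by (simp add: node_def)
  have "\<exists>a\<in>A. dle (odd i) (under r a) (c i)" for i using ex_under_dle zigzag_X[OF z] by blast
  then obtain f where f: "f i \<in> A" "dle (odd i) (under r (f i)) (c i)" for i by metis
  have far: "(f i, f j) \<notin> r" "(f j, f i) \<notin> r" if "i + 2 \<le> j" for i j
    using zigzag_incomparable[OF z _ that f(1)[of i] _ f(1)[of j], of True]
      zigzag_incomparable[OF z _ that f(1)[of i] _ f(1)[of j], of False] f under_subset_iff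
    by (auto simp: node dle_def)
  have adj: "(f i, f (i + 1)) \<in> r \<longleftrightarrow> odd i" "(f (i + 1), f i) \<in> r \<longleftrightarrow> even i" for i
  proof -
    have e: "dle (odd i) (c i) (c (i + 1))" "c i \<noteq> c (i + 1)" using zigzag_edge[OF z, of i] node by auto
    have "dle (odd i) (c (i + 1)) (under r (f (i + 1)))" using f(2)[of "i + 1"] by (simp add: dle_def)
    then have 1: "dle (odd i) (c i) (under r (f (i + 1)))" using dle_trans[OF e(1)] by simp
    have 2: "dle (odd i) (under r (f i)) (under r (f (i + 1)))" using dle_trans[OF f(2) 1] .
    have "under r (f i) \<noteq> under r (f (i + 1))"
    proof
      assume "under r (f i) = under r (f (i + 1))"
      then have "dle (odd i) (c (i + 1)) (c i)" using f(2)[of i] f(2)[of "i + 1"]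
        by (auto simp: dle_def split: if_splits)
      then show False using e dle_antisym by blast
    qed
    then show "(f i, f (i + 1)) \<in> r \<longleftrightarrow> odd i" "(f (i + 1), f i) \<in> r \<longleftrightarrow> even i"
      using 2 under_subset_iff[OF f(1), of i "f (i + 1)"] under_subset_iff[OF f(1), of "i + 1" "f i"]
      by (auto simp: dle_def split: if_splits)
  qed
  have iff: "(f i, f j) \<in> r \<longleftrightarrow> (i, j) \<in> Alt" for i j
  proof -
    consider "i = j" | "j = i + 1" | "i = j + 1" | "i + 2 \<le> j" | "j + 2 \<le> i" by linarith
    then show ?thesis
      by cases (use adj[of i] adj[of j] far[of i j] far[of j i] r_refl[OF f(1)] in \<open>auto simp: Alt_def\<close>)
  qed
  have "inj f"
  proof
    fix i j assume "f i = f j"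
    then have "(i, j) \<in> Alt" "(j, i) \<in> Alt" using iff[of i j] iff[of j i] r_refl[OF f(1)] by auto
    then show "i = j" by (auto simp: Alt_def)
  qed
  then show ?thesis
    unfolding order_embeds_def Field_r using iff f(1) by (auto intro!: exI[of _ f] intro: inj_on_subset)
qed

lemma zigzag_UNIV_embeds_Alt:
  assumes z: "zigzag b UNIV c"
  shows "order_embeds Alt r"
proof (cases b)
  case True
  then have "zigzag False UNIV (\<lambda>i. c (i + 1))" using zigzag_shift[OF z, of 1] by (simp add: node_def)
  then show ?thesis by (rule zigzag_UNIV_embeds_Alt')
next
  case False then show ?thesis using z zigzag_UNIV_embeds_Alt' by simp
qed

section \<open>Changing the origin of a ray and splicing rays\<close>

definition ray :: "bool \<Rightarrow> 'a set \<Rightarrow> (int \<Rightarrow> 'a set) \<Rightarrow> bool" where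
  "ray b x c \<longleftrightarrow> zigzag b {0..} c \<and> c 0 = x"

lemma ray_X: "ray b x c \<Longrightarrow> 0 \<le> i \<Longrightarrow> c i \<in> X"
  using zigzag_X by (auto simp: ray_def)

lemma ray_start: "ray b x c \<Longrightarrow> x \<in> X"
  using ray_X[of b x c 0] by (simp add: ray_def)

lemma ray_edge: "ray b x c \<Longrightarrow> dle b x (c 1) \<and> x \<noteq> c 1"
  using zigzag_edge[of b "{0..}" c 0] by (auto simp: ray_def)

lemma ray_tight: "ray b x c \<Longrightarrow> tight (\<not> b) x (c 1) (c 2)"
  using zigzag_tight[of b "{0..}" c 1] by (auto simp: ray_def node_def)

lemma ray_shift:
  assumes "ray b x c" shows "ray (\<not> b) (c 1) (\<lambda>i. c (i + 1))"
proof -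
  have "zigzag b {0..} c" using assms by (simp add: ray_def)
  from zigzag_shift[OF this, of 1] have "zigzag (\<not> b) {i. i + 1 \<in> {0..}} (\<lambda>i. c (i + 1))"
    by (simp add: node_def)
  then have "zigzag (\<not> b) {0..} (\<lambda>i. c (i + 1))" by (rule zigzag_mono) auto
  then show ?thesis by (simp add: ray_def)
qed

lemma ray_extend:
  assumes c: "ray b x c" and y: "y \<in> X" "dle b y x"
  shows "ray b y (c(0 := y))"
proof -
  have "zigzag b {0..} (c(0 := y))"
    by (rule zigzag_replace_end) (use c y in \<open>auto simp: ray_def\<close>)
  then show ?thesis by (simp add: ray_def)
qed

lemma ray_shrink:
  assumes c: "ray b x c" and y: "y \<in> X" "dle b x y" "dle b y (c 1)" "y \<noteq> c 1"
  shows "ray b y (c(0 := y))"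
  unfolding ray_def
proof (rule conjI, rule zigzagI)
  have z: "zigzag b {0..} c" using c by (simp add: ray_def)
  fix i :: int
  { assume i: "i \<in> {0..}"
    then show "(c(0 := y)) i \<in> X" using ray_X[OF c] y by auto }
  { assume i: "i \<in> {0..}" "i + 1 \<in> {0..}"
    then show "dle (node b i) ((c(0 := y)) i) ((c(0 := y)) (i + 1)) \<and> (c(0 := y)) i \<noteq> (c(0 := y)) (i + 1)"
      using zigzag_edge[OF z i] y by auto }
  { assume i: "i - 1 \<in> {0..}" "i \<in> {0..}" "i + 1 \<in> {0..}"
    have "tight (\<not> b) y (c 1) (c 2)"
      by (rule tight_shrink[OF ray_tight[OF c]]) (use y in auto)
    then show "tight (node b i) ((c(0 := y)) (i - 1)) ((c(0 := y)) i) ((c(0 := y)) (i + 1))"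
      using zigzag_tight[OF z i] i by (cases "i = 1") (auto simp: node_def) }
qed simp

lemma ray_cons:
  assumes c: "ray b x c" and y: "y \<in> X" "tight b y x (c 1)"
  shows "ray (\<not> b) y (\<lambda>i. if i = 0 then y else c (i - 1))"
  unfolding ray_def
proof (rule conjI, rule zigzagI)
  have z: "zigzag b {0..} c" "c 0 = x" using c by (auto simp: ray_def)
  have node': "node (\<not> b) i = node b (i - 1)" for i by (auto simp: node_def)
  let ?e = "\<lambda>i. if i = 0 then y else c (i - 1)"
  fix i :: int
  { assume i: "i \<in> {0..}"
    then show "?e i \<in> X" using ray_X[OF c, of "i - 1"] y by auto }
  { assume i: "i \<in> {0..}" "i + 1 \<in> {0..}"
    then show "dle (node (\<not> b) i) (?e i) (?e (i + 1)) \<and> ?e i \<noteq> ?e (i + 1)"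
      using zigzag_edge[OF z(1), of "i - 1"] tight_dle[OF y(2)] not_sym[of x y] z(2)
      by (cases "i = 0") (simp_all add: node') }
  { assume i: "i - 1 \<in> {0..}" "i \<in> {0..}" "i + 1 \<in> {0..}"
    then show "tight (node (\<not> b) i) (?e (i - 1)) (?e i) (?e (i + 1))"
      using zigzag_tight[OF z(1), of "i - 1"] y(2) z(2) by (cases "i = 1") (simp_all add: node') }
qed simp

text \<open>The ray \<open>d\<close>, read backwards on the negative indices, and \<open>c\<close>
  on the others form a two-sided zigzag; the hypothesis \<open>t\<close> is the tightness missing at
  index 0.\<close>

lemma ray_fork_embeds_Alt:
  assumes c: "ray b x c" and d: "ray b x d" and t: "tight b (d 1) x (c 1)"
  shows "order_embeds Alt r"
proof (rule zigzag_UNIV_embeds_Alt)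
  let ?e = "\<lambda>i. if 0 \<le> i then c i else d (- i)"
  have zc: "zigzag b {0..} c" "c 0 = x" using c by (auto simp: ray_def)
  have zd: "zigzag b {0..} d" "d 0 = x" using d by (auto simp: ray_def)
  show "zigzag b UNIV ?e"
  proof (rule zigzagI)
    fix i :: int
    show "?e i \<in> X" using ray_X[OF c, of i] ray_X[OF d, of "- i"] by auto
    have e: "?e i = d (- i)" if "i \<le> 0" for i using that zc zd by auto
    show "dle (node b i) (?e i) (?e (i + 1)) \<and> ?e i \<noteq> ?e (i + 1)"
    proof (cases "0 \<le> i")
      case True then show ?thesis using zigzag_edge[OF zc(1), of i] by auto
    next
      case False
      then have "dle (node b (- (i + 1))) (d (- (i + 1))) (d (- i)) \<and> d (- (i + 1)) \<noteq> d (- i)"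
        using zigzag_edge[OF zd(1), of "- (i + 1)"] by auto
      then show ?thesis
        using False e[of i] e[of "i + 1"] unfolding node_minus node_Suc dle_Not by auto
    qed
    consider "i = 0" | "1 \<le> i" | "i \<le> - 1" by linarith
    then show "tight (node b i) (?e (i - 1)) (?e i) (?e (i + 1))"
    proof cases
      case 1 then show ?thesis using t zc by auto
    next
      case 2 then show ?thesis using zigzag_tight[OF zc(1), of i] by auto
    next
      case 3
      have "- i - 1 = - (i + 1)" "- i + 1 = - (i - 1)" by simp_all
      then have "tight (node b i) (d (- (i + 1))) (d (- i)) (d (- (i - 1)))"
        using zigzag_tight[OF zd(1), of "- i"] 3 by simp
      then show ?thesis
        using 3 e[of i] e[of "i + 1"] e[of "i - 1"] tight_commute by auto
    qed
  qed
qed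

text \<open>Either \<open>y\<close> is on the first segment before \<open>c 1\<close>, or at or
  beyond \<open>c 1\<close>, or it branches off at the meet \<open>m\<close> of \<open>y\<close> and
  \<open>c 1\<close>. Its ray then goes to \<open>c 1\<close>, passes through \<open>c 1\<close>
  straight to \<open>c 2\<close>, or turns at \<open>m\<close> into the given ray. The first turning
  point is recorded to locate where the two rays merge.\<close>

lemma ray_comparable:
  assumes c: "ray b x c" and y: "y \<in> X" "dle b x y"
  shows "(dle b y (c 1) \<and> y \<noteq> c 1 \<and> (\<exists>d. ray b y d \<and> d 1 = c 1)) \<or>
     (dle b (c 1) y \<and> (\<exists>d. ray (\<not> b) y d \<and> d 1 = c 2)) \<or>
     (\<exists>d. ray (\<not> b) y d \<and> d 1 \<in> X \<and> dle b x (d 1) \<and> dle b (d 1) (c 1) \<and> d 1 \<noteq> c 1 \<and> dle b (d 1) y)"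
proof -
  consider "dle b y (c 1)" "y \<noteq> c 1" | "dle b (c 1) y" | "\<not> dle b y (c 1)" "\<not> dle b (c 1) y"
    using dle_refl by blast
  then show ?thesis
  proof cases
    case 1
    then have "ray b y (c(0 := y))" using ray_shrink[OF c y] by blast
    then show ?thesis using 1 by (metis fun_upd_apply zero_neq_one)
  next
    case 2
    then have "ray (\<not> b) y ((\<lambda>i. c (i + 1))(0 := y))"
      using ray_extend[OF ray_shift[OF c] y(1)] by simp
    moreover have "((\<lambda>i. c (i + 1))(0 := y)) 1 = c 2" by simp
    ultimately show ?thesis using 2 by blast
  next
    case 3
    have cX: "c 1 \<in> X" using ray_X[OF c] by simp
    obtain m where m: "m \<in> X" "dle b m y" "dle b m (c 1)"
      and inf: "\<And>z. \<lbrakk>z \<in> X; dle b z y; dle b z (c 1)\<rbrakk> \<Longrightarrow> dle b z m"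
      using ex_inf[OF y(1) cX ray_start[OF c] y(2)] ray_edge[OF c] by blast
    have xm: "dle b x m" using inf ray_start[OF c] y ray_edge[OF c] by blast
    have ne: "m \<noteq> y" "m \<noteq> c 1" using 3 m by auto
    have rm: "ray b m (c(0 := m))" using ray_shrink[OF c m(1) xm m(3) ne(2)] .
    have "z = m" if "z \<in> X" "dle b m z" "dle b z y" "dle b z (c 1)" for z
      using inf[OF that(1,3,4)] that(2) dle_antisym by blast
    then have "tight b y m ((c(0 := m)) 1)" using m ne by (auto simp: tight_def)
    note rc = ray_cons[OF rm y(1) this]
    show ?thesis
      by (intro disjI2 exI[of _ "\<lambda>i. if i = 0 then y else (c(0 := m)) (i - 1)"] conjI)
        (use m xm ne rc in simp_all)
  qed
qed

end

section \<open>Uniqueness and existence of rays\<close>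

locale cycle_free_omega = cycle_free +
  assumes Alt_omega: "order_embeds Alt_omega r"
    and no_Alt: "\<not> order_embeds Alt r"
    and connected: "\<lbrakk>a \<in> A; b \<in> A\<rbrakk> \<Longrightarrow> \<exists>p. is_path r a b p"
begin

text \<open>The two rays leave \<open>x\<close> in opposite directions, so \<open>x\<close> is no
  turning point of their union. The splice is made at \<open>c 1\<close> instead: \<open>d\<close>
  is prolonged backwards through \<open>x\<close> to start there.\<close>

lemma ray_direction_unique:
  assumes c: "ray b x c" and d: "ray (\<not> b) x d"
  shows False
proof -
  have X: "x \<in> X" "c 1 \<in> X" "d 1 \<in> X" using ray_start[OF c] ray_X[OF c] ray_X[OF d] by auto
  have c': "ray (\<not> b) (c 1) (\<lambda>i. c (i + 1))" using ray_shift[OF c] .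
  have d': "ray (\<not> b) (c 1) (d(0 := c 1))"
    by (rule ray_extend[OF d X(2)]) (use ray_edge[OF c] in simp)
  have "tight (\<not> b) (d 1) (c 1) (c 2)"
    using tight_extend[OF ray_tight[OF c] X] ray_edge[OF d] by blast
  then show False using ray_fork_embeds_Alt[OF c' d'] no_Alt by simp
qed

text \<open>If \<open>c 1\<close> came strictly before \<open>d 1\<close>, one could go back from
  \<open>d 1\<close> past \<open>c 1\<close> to \<open>c 2\<close> without turning; this gives a
  second ray from \<open>d 1\<close>, forking tightly from the tail of \<open>d\<close>.\<close>

lemma ray_next_eq:
  assumes c: "ray b x c" and d: "ray b x d" and le: "dle b (c 1) (d 1)"
  shows "c 1 = d 1"
proof (rule ccontr)
  assume ne: "c 1 \<noteq> d 1"
  have X: "x \<in> X" "c 1 \<in> X" "d 1 \<in> X" "c 2 \<in> X"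
    using ray_start[OF c] ray_X[OF c] ray_X[OF d] by auto
  have d': "ray (\<not> b) (d 1) (\<lambda>i. d (i + 1))" using ray_shift[OF d] .
  have c': "ray (\<not> b) (d 1) ((\<lambda>i. c (i + 1))(0 := d 1))"
    by (rule ray_extend[OF ray_shift[OF c] X(3)]) (use le in simp)
  have "tight (\<not> b) (c 1) (d 1) (d 2)"
    by (rule tight_shrink[OF ray_tight[OF d]]) (use le ne ray_edge[OF c] in auto)
  then have "tight (\<not> b) (c 2) (d 1) (d 2)"
    by (rule tight_extend) (use X tight_dle[OF ray_tight[OF c]] in auto)
  then show False using ray_fork_embeds_Alt[OF d' c'] no_Alt by simp
qed

text \<open>Incomparable first turning points would have a meet \<open>m\<close>, and both rays,
  shortened to start at \<open>m\<close>, would fork there. Comparing first turning points is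
  enough, since tails of rays are again rays.\<close>

lemma ray_unique:
  assumes c: "ray b x c" and d: "ray b' x d"
  shows "b = b' \<and> c 1 = d 1"
proof -
  have b: "b' = b" using ray_direction_unique[OF c] d by (cases b; cases b') auto
  have d: "ray b x d" using d b by simp
  have X: "x \<in> X" "c 1 \<in> X" "d 1 \<in> X" using ray_start[OF c] ray_X[OF c] ray_X[OF d] by auto
  have "dle b (c 1) (d 1) \<or> dle b (d 1) (c 1)"
  proof (rule ccontr)
    assume inc: "\<not> ?thesis"
    obtain m where m: "m \<in> X" "dle b m (c 1)" "dle b m (d 1)"
      and inf: "\<And>z. \<lbrakk>z \<in> X; dle b z (c 1); dle b z (d 1)\<rbrakk> \<Longrightarrow> dle b z m"
      using ex_inf[OF X(2,3,1), of b] ray_edge[OF c] ray_edge[OF d] by blast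
    have xm: "dle b x m" using inf X ray_edge[OF c] ray_edge[OF d] by blast
    have ne: "m \<noteq> c 1" "m \<noteq> d 1" using inc m by auto
    have "z = m" if "z \<in> X" "dle b m z" "dle b z (d 1)" "dle b z (c 1)" for z
      using inf[OF that(1,4,3)] that(2) dle_antisym by blast
    then have "tight b (d 1) m (c 1)" using m ne by (auto simp: tight_def)
    then show False
      using ray_fork_embeds_Alt[OF ray_shrink[OF c m(1) xm m(2) ne(1)] ray_shrink[OF d m(1) xm m(3) ne(2)]]
        no_Alt by simp
  qed
  then show ?thesis using ray_next_eq[OF c d] ray_next_eq[OF d c] b by auto
qed

text \<open>Connectedness links points of \<open>A\<close> only, so \<open>x\<close> and
  \<open>y\<close> are lowered to such points, and a connecting set provides the finitely many
  comparable steps in between.\<close>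

lemma comparability_induct:
  assumes x: "x \<in> X" "P x" and y: "y \<in> X"
    and step: "\<And>u v. \<lbrakk>P u; u \<in> X; v \<in> X; u \<subseteq> v \<or> v \<subseteq> u\<rbrakk> \<Longrightarrow> P v"
  shows "P y"
proof -
  obtain a where a: "a \<in> A" "under r a \<subseteq> x" using ex_under_dle[OF x(1), of True] by (auto simp: dle_def)
  obtain b where b: "b \<in> A" "under r b \<subseteq> y" using ex_under_dle[OF y, of True] by (auto simp: dle_def)
  obtain p where "is_path r a b p" using connected[OF a(1) b(1)] by blast
  then obtain c where c: "connecting_set r a b c" unfolding is_path_def by blast
  have ne: "c \<noteq> []" using c by (auto simp: connecting_set_def)
  have "P (c ! i)" if "i < length c" for i
    using that
  proof (induction i)
    case 0
    have "P (under r a)" using step[OF x(2,1) under_X[OF a(1)]] a by blast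
    then show ?case using c ne by (simp add: connecting_set_def hd_conv_nth)
  next
    case (Suc i)
    have "c ! i \<subseteq> c ! Suc i \<or> c ! Suc i \<subseteq> c ! i" using c Suc.prems by (simp add: connecting_set_def)
    moreover have "c ! i \<in> X" "c ! Suc i \<in> X"
      using c Suc.prems nth_mem[of i c] nth_mem[of "Suc i" c] unfolding connecting_set_def by auto
    ultimately show ?case using step Suc by simp
  qed
  then have "P (last c)" using ne by (simp add: last_conv_nth)
  then have "P (under r b)" using c by (simp add: connecting_set_def)
  then show ?thesis using step[OF _ under_X[OF b(1)] y] b by blast
qed

text \<open>The images \<open>u i\<close> of the alternating chain need not be tight turning points.
  Each upper one (even index) is lowered to the join \<open>P i\<close> of its neighbours; then each
  lower one is raised to the meet \<open>V i\<close> of the neighbouring joins.\<close>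

lemma Alt_omega_ray: "\<exists>b x c. ray b x c"
proof -
  obtain f where f: "inj_on f (Field Alt_omega) \<and> f ` Field Alt_omega \<subseteq> Field r \<and>
    (\<forall>x \<in> Field Alt_omega. \<forall>y \<in> Field Alt_omega. (f x, f y) \<in> r \<longleftrightarrow> (x, y) \<in> Alt_omega)"
    using Alt_omega unfolding order_embeds_def by (rule exE)
  have F: "Field Alt_omega = {0..}" by (auto simp: Field_def Alt_omega_def Alt_def)
  have fA: "f i \<in> A" if "0 \<le> i" for i using f F Field_r that by auto
  define u where "u i = under r (f i)" for i
  have uX: "u i \<in> X" if "0 \<le> i" for i using under_X fA that by (simp add: u_def)
  have u: "u i \<subseteq> u j \<longleftrightarrow> i = j \<or> odd i \<and> (j = i - 1 \<or> j = i + 1)" if "0 \<le> i" "0 \<le> j" for i j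
  proof -
    have "u i \<subseteq> u j \<longleftrightarrow> (i, j) \<in> Alt_omega"
      using f that F under_subset_iff[OF fA, of i "f j"] by (simp add: u_def)
    then show ?thesis using that by (auto simp: Alt_omega_def Alt_def)
  qed
  have upper: "u (i - 1) \<subseteq> u i" "u (i + 1) \<subseteq> u i" if "even i" "2 \<le> i" for i
    using u[of "i - 1" i] u[of "i + 1" i] that by auto
  have "\<forall>i\<in>{i. even i \<and> 2 \<le> i}. \<exists>m. m \<in> X \<and> u (i - 1) \<subseteq> m \<and> u (i + 1) \<subseteq> m \<and>
      (\<forall>z\<in>X. u (i - 1) \<subseteq> z \<longrightarrow> u (i + 1) \<subseteq> z \<longrightarrow> m \<subseteq> z)"
    using ex_inf[of "u (i - 1)" "u (i + 1)" "u i" False for i, unfolded dle_def] upper uX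
    by (simp add: Bex_def)
  then obtain P where P': "\<forall>i\<in>{i. even i \<and> 2 \<le> i}. P i \<in> X \<and> u (i - 1) \<subseteq> P i \<and> u (i + 1) \<subseteq> P i \<and>
      (\<forall>z\<in>X. u (i - 1) \<subseteq> z \<longrightarrow> u (i + 1) \<subseteq> z \<longrightarrow> P i \<subseteq> z)"
    unfolding bchoice_iff by blast
  have P: "P i \<in> X" "u (i - 1) \<subseteq> P i" "u (i + 1) \<subseteq> P i" "P i \<subseteq> u i"
      and Pl: "\<And>z. z \<in> X \<Longrightarrow> u (i - 1) \<subseteq> z \<Longrightarrow> u (i + 1) \<subseteq> z \<Longrightarrow> P i \<subseteq> z"
    if "even i" "2 \<le> i" for i
    using P' that upper[OF that] uX[of i] by simp_all
  have lower: "u i \<subseteq> P (i - 1)" "u i \<subseteq> P (i + 1)" "P (i - 1) \<in> X" "P (i + 1) \<in> X" if "odd i" "2 \<le> i" for i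
  proof -
    have "i \<noteq> 2" using that by auto
    then show "u i \<subseteq> P (i - 1)" "u i \<subseteq> P (i + 1)" "P (i - 1) \<in> X" "P (i + 1) \<in> X"
      using P(1,3)[of "i - 1"] P(1,2)[of "i + 1"] that by auto
  qed
  have "\<forall>i\<in>{i. odd i \<and> 2 \<le> i}. \<exists>m. m \<in> X \<and> m \<subseteq> P (i - 1) \<and> m \<subseteq> P (i + 1) \<and>
      (\<forall>z\<in>X. z \<subseteq> P (i - 1) \<longrightarrow> z \<subseteq> P (i + 1) \<longrightarrow> z \<subseteq> m)"
    using ex_inf[of "P (i - 1)" "P (i + 1)" "u i" True for i, unfolded dle_def] lower uX
    by (simp add: Bex_def)
  then obtain V where V': "\<forall>i\<in>{i. odd i \<and> 2 \<le> i}. V i \<in> X \<and> V i \<subseteq> P (i - 1) \<and> V i \<subseteq> P (i + 1) \<and>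
      (\<forall>z\<in>X. z \<subseteq> P (i - 1) \<longrightarrow> z \<subseteq> P (i + 1) \<longrightarrow> z \<subseteq> V i)"
    unfolding bchoice_iff by blast
  have V: "V i \<in> X" "V i \<subseteq> P (i - 1)" "V i \<subseteq> P (i + 1)" "u i \<subseteq> V i"
      and Vg: "\<And>z. z \<in> X \<Longrightarrow> z \<subseteq> P (i - 1) \<Longrightarrow> z \<subseteq> P (i + 1) \<Longrightarrow> z \<subseteq> V i"
    if "odd i" "2 \<le> i" for i
    using V' that lower[OF that] uX[of i] by simp_all
  define c where "c i = (if even i then P i else V i)" for i
  have node: "node False i = odd i" for i by (simp add: node_def)
  \<comment> \<open>An equality would yield an inclusion between two of the points \<open>u\<close>
    whose indices differ by 3, which \<open>Alt_omega\<close> does not allow.\<close>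
  have VP: "V i \<noteq> P (i + 1)" "V i \<noteq> P (i - 1)" if i: "odd i" "3 \<le> i" for i
  proof -
    have j: "even (i + 1)" "2 \<le> i + 1" "even (i - 1)" "2 \<le> i - 1" using i by auto
    have "u (i + 2) \<subseteq> P (i + 1)" using P(3)[OF j(1,2)] by (simp add: add.commute)
    moreover have "\<not> u (i + 2) \<subseteq> u (i - 1)" using u[of "i + 2" "i - 1"] i by auto
    ultimately show "V i \<noteq> P (i + 1)" using V(2)[of i] P(4)[OF j(3,4)] i by auto
    have "u (i - 2) \<subseteq> P (i - 1)" using P(2)[OF j(3,4)] by (simp add: add.commute)
    moreover have "\<not> u (i - 2) \<subseteq> u (i + 1)" using u[of "i - 2" "i + 1"] i by auto
    ultimately show "V i \<noteq> P (i - 1)" using V(3)[of i] P(4)[OF j(1,2)] i by auto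
  qed
  \<comment> \<open>\<open>P 0\<close> would need a left neighbour of \<open>u 0\<close>, and
    \<open>V 1\<close> would need \<open>P 0\<close>; hence the start at 2 and the final
    shift.\<close>
  have "zigzag False {2..} c"
  proof (rule zigzagI, unfold node)
    fix i :: int
    { assume i: "i \<in> {2..}"
      then show "c i \<in> X" using P(1)[of i] V(1)[of i] by (auto simp: c_def) }
    { assume i: "i \<in> {2..}" "i + 1 \<in> {2..}"
      show "dle (odd i) (c i) (c (i + 1)) \<and> c i \<noteq> c (i + 1)"
      proof (cases "odd i")
        case True
        then have "3 \<le> i" using i by (cases "i = 2") auto
        then show ?thesis using True V(3)[of i] VP[of i] i by (auto simp: c_def dle_def)
      next
        case False
        then show ?thesis using V(2)[of "i + 1"] VP(2)[of "i + 1"] i by (auto simp: c_def dle_def)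
      qed }
    { assume i: "i - 1 \<in> {2..}" "i \<in> {2..}" "i + 1 \<in> {2..}"
      show "tight (odd i) (c (i - 1)) (c i) (c (i + 1))"
      proof (cases "odd i")
        case True
        then show ?thesis
          using V(2,3)[of i] VP[of i] Vg[of i] i by (auto simp: c_def dle_def tight_def)
      next
        case False
        then have "4 \<le> i" using i by (cases "i = 3") auto
        then have j: "odd (i - 1)" "2 \<le> i - 1" "3 \<le> i - 1" "odd (i + 1)" "2 \<le> i + 1" "3 \<le> i + 1"
          using False by auto
        \<comment> \<open>Raising the lower points does not spoil the joins: a bound of the two
          points \<open>V\<close> also bounds the two points \<open>u\<close> below them.\<close>
        have "z = P i" if z: "z \<in> X" "z \<subseteq> P i" "V (i - 1) \<subseteq> z" "V (i + 1) \<subseteq> z" for z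
        proof
          have "u (i - 1) \<subseteq> z" "u (i + 1) \<subseteq> z" using V(4)[OF j(1,2)] V(4)[OF j(4,5)] z by auto
          then show "P i \<subseteq> z" using Pl[of i z] False i z by simp
        qed (rule z)
        moreover have "V (i - 1) \<subseteq> P i" "V (i + 1) \<subseteq> P i" "P i \<noteq> V (i - 1)" "P i \<noteq> V (i + 1)"
          using V(3)[OF j(1,2)] V(2)[OF j(4,5)] VP(1)[OF j(1,3)] VP(2)[OF j(4,6)] by auto
        ultimately show ?thesis using False by (simp add: c_def dle_def tight_def)
      qed }
  qed
  then have "zigzag (node False 2) {i. i + 2 \<in> {2..}} (\<lambda>i. c (i + 2))" by (rule zigzag_shift)
  moreover have "{i. i + 2 \<in> {2..}} = {0 :: int..}" by auto
  ultimately have "zigzag False {0..} (\<lambda>i. c (i + 2))" by (simp add: node_def)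
  then show ?thesis by (auto simp: ray_def)
qed

text \<open>Existence spreads along comparabilities: a step against the starting direction prolongs
  the ray, a step along it is covered by \<open>ray_comparable\<close>.\<close>

lemma ex_ray: "y \<in> X \<Longrightarrow> \<exists>b c. ray b y c"
proof -
  assume y: "y \<in> X"
  obtain b x c where c: "ray b x c" using Alt_omega_ray by blast
  show ?thesis
  proof (rule comparability_induct[OF ray_start[OF c] _ y])
    show "\<exists>b c. ray b x c" using c by blast
    fix u v assume "\<exists>b c. ray b u c" and uv: "u \<in> X" "v \<in> X" "u \<subseteq> v \<or> v \<subseteq> u"
    then obtain b c where c: "ray b u c" by blast
    have "dle b u v \<or> dle b v u" using uv by (auto simp: dle_def)
    then show "\<exists>b c. ray b v c" using ray_comparable[OF c uv(2)] ray_extend[OF c uv(2)] by blast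
  qed
qed

end

section \<open>The tree order directed towards the end\<close>

context cycle_free_omega
begin

text \<open>
  \<open>ty x\<close> says that the rays from \<open>x\<close> start upwards, and \<open>par x\<close> is their common first turning point.
\<close>

definition ty :: "'a set \<Rightarrow> bool" where
  "ty x = (SOME b. \<exists>c. ray b x c)"

definition par :: "'a set \<Rightarrow> 'a set" where
  "par x = (SOME y. \<exists>b c. ray b x c \<and> y = c 1)"

lemma ray_ty_par:
  assumes "ray b x c" shows "ty x = b" "par x = c 1"
proof -
  have "\<exists>b c. ray b x c" using assms by blast
  then have "\<exists>c. ray (ty x) x c" unfolding ty_def by (rule someI_ex)
  then show "ty x = b" using ray_unique[OF assms] by blast
  have "\<exists>y b c. ray b x c \<and> y = c 1" using assms by blast
  then have "\<exists>b c. ray b x c \<and> par x = c 1" unfolding par_def by (rule someI_ex)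
  then show "par x = c 1" using ray_unique[OF assms] by auto
qed

lemma ex_ray_par:
  assumes "x \<in> X" obtains c where "ray (ty x) x c" "c 1 = par x"
proof -
  obtain b c where "ray b x c" using ex_ray[OF assms] by blast
  then show ?thesis using ray_ty_par[of b x c] that by simp
qed

lemma ray_par:
  assumes c: "ray b x c" and k: "0 \<le> k"
  shows "par (c k) = c (k + 1)"
proof -
  have "zigzag (node b k) {i. i + k \<in> {0..}} (\<lambda>i. c (i + k))"
    by (rule zigzag_shift) (use c in \<open>simp add: ray_def\<close>)
  then have "zigzag (node b k) {0..} (\<lambda>i. c (i + k))" by (rule zigzag_mono) (use k in auto)
  then have "ray (node b k) (c k) (\<lambda>i. c (i + k))" by (simp add: ray_def)
  from ray_ty_par(2)[OF this] show ?thesis by (simp add: add.commute)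
qed

lemma par_X:
  assumes "x \<in> X" shows "par x \<in> X"
proof -
  obtain c where "ray (ty x) x c" "c 1 = par x" using ex_ray_par[OF assms] .
  then show ?thesis using ray_X[of "ty x" x c 1] by simp
qed

lemma par_dle:
  assumes "x \<in> X" shows "dle (ty x) x (par x) \<and> x \<noteq> par x"
proof -
  obtain c where "ray (ty x) x c" "c 1 = par x" using ex_ray_par[OF assms] .
  then show ?thesis using ray_edge[of "ty x" x c] by simp
qed

lemma ty_par:
  assumes "x \<in> X" shows "ty (par x) = (\<not> ty x)"
proof -
  obtain c where "ray (ty x) x c" "c 1 = par x" using ex_ray_par[OF assms] .
  then show ?thesis using ray_ty_par(1)[OF ray_shift[of "ty x" x c]] by simp
qed

section \<open>Segments and the tree order\<close>

abbreviation seg :: "'a set \<Rightarrow> 'a set set" where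
  "seg x \<equiv> interval r x (par x)"

lemma seg_iff: "x \<in> X \<Longrightarrow> z \<in> seg x \<longleftrightarrow> z \<in> X \<and> dle (ty x) x z \<and> dle (ty x) z (par x)"
  using interval_iff[of "ty x" x "par x"] par_dle by blast

text \<open>Shortening the first segment keeps its end. The point \<open>par x\<close> is excluded
  because the ray turns there.\<close>

lemma seg_ty_par:
  assumes x: "x \<in> X" and z: "z \<in> seg x" "z \<noteq> par x"
  shows "ty z = ty x" "par z = par x"
proof -
  obtain c where c: "ray (ty x) x c" "c 1 = par x" using ex_ray_par[OF x] .
  have "ray (ty x) z (c(0 := z))"
    by (rule ray_shrink[OF c(1)]) (use x z c(2) seg_iff in auto)
  from ray_ty_par[OF this] show "ty z = ty x" "par z = par x" using c by auto
qed

lemma seg_mono: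
  assumes x: "x \<in> X" and z: "z \<in> seg x" "z \<noteq> par x"
  shows "w \<in> seg z \<longleftrightarrow> w \<in> seg x \<and> dle (ty x) z w"
proof -
  have zX: "z \<in> X" and xz: "dle (ty x) x z" using seg_iff[OF x] z by auto
  have "w \<in> seg z \<longleftrightarrow> w \<in> X \<and> dle (ty x) z w \<and> dle (ty x) w (par x)"
    using seg_iff[OF zX, of w] seg_ty_par[OF assms] by simp
  then show ?thesis using seg_iff[OF x, of w] dle_trans[OF xz, of w] by blast
qed

text \<open>The smaller element is the one nearer to the end. Unrolling the ray from
  \<open>x\<close> by \<open>par\<close>, one segment at a time, allows induction on segments
  without naming a ray.\<close>

inductive tle :: "'a set \<Rightarrow> 'a set \<Rightarrow> bool" for z where
  tle_seg: "x \<in> X \<Longrightarrow> z \<in> seg x \<Longrightarrow> tle z x"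
| tle_step: "x \<in> X \<Longrightarrow> tle z (par x) \<Longrightarrow> tle z x"

lemma tle_X: "tle z x \<Longrightarrow> z \<in> X \<and> x \<in> X"
  by (induction rule: tle.induct) (auto simp: seg_iff)

lemma tle_refl: "x \<in> X \<Longrightarrow> tle x x"
  by (rule tle_seg) (use par_dle in \<open>auto simp: seg_iff\<close>)

lemma tle_par: "x \<in> X \<Longrightarrow> tle (par x) x"
  by (rule tle_step) (auto intro: tle_refl par_X)

lemma tle_of_seg:
  assumes x: "x \<in> X" and z: "z \<in> seg x" and w: "tle w (par x)"
  shows "tle w z"
proof (cases "z = par x")
  case False
  then show ?thesis using tle_step[of z w] seg_ty_par[OF x z] seg_iff[OF x] z w by auto
qed (use w in simp)

lemma tle_seg_trans:
  assumes x: "x \<in> X" and z: "z \<in> seg x" and w: "tle w z"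
  shows "tle w x"
proof (cases "z = par x")
  case True then show ?thesis using tle_step[OF x] w by simp
next
  case False
  from w show ?thesis
  proof cases
    case tle_seg
    then show ?thesis using tle.tle_seg[OF x] seg_mono[OF x z False] by blast
  next
    case tle_step
    then show ?thesis using tle.tle_step[OF x] seg_ty_par[OF x z False] by simp
  qed
qed

lemma tle_trans: "tle z x \<Longrightarrow> tle w z \<Longrightarrow> tle w x"
  by (induction rule: tle.induct) (auto intro: tle_seg_trans tle_step)

lemma seg_chain:
  assumes x: "x \<in> X" and y: "y \<in> seg x" and z: "z \<in> seg x"
  shows "tle y z \<or> tle z y"
proof -
  have *: "tle v u" if "u \<in> seg x" "v \<in> seg x" "dle (ty x) u v" for u v
  proof (cases "u = par x")
    case True
    then have "u = v" using that seg_iff[OF x] dle_antisym by blast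
    then show ?thesis using tle_refl that seg_iff[OF x] by blast
  next
    case False
    then show ?thesis using tle_seg[of u v] seg_mono[OF x that(1) False] seg_iff[OF x] that by blast
  qed
  have "dle (ty x) y z \<or> dle (ty x) z y"
    using dle_chain[OF x par_X[OF x]] y z seg_iff[OF x] by blast
  then show ?thesis using * y z by blast
qed

text \<open>Two points on the first segment are compared by its linearity; if only one is there, the
  other is nearer to the end; otherwise both lie on the ray from \<open>par x\<close>.\<close>

lemma tle_chain: "tle y x \<Longrightarrow> tle z x \<Longrightarrow> tle y z \<or> tle z y"
proof (induction rule: tle.induct)
  case (tle_seg x)
  from \<open>tle z x\<close> show ?case
  proof cases
    case tle_seg then show ?thesis using seg_chain \<open>y \<in> seg x\<close> by blast
  next
    case tle_step then show ?thesis using tle_of_seg \<open>y \<in> seg x\<close> by blast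
  qed
next
  case (tle_step x)
  from \<open>tle z x\<close> show ?case
  proof cases
    case tle_seg then show ?thesis using tle_of_seg tle_step.hyps by blast
  next
    case tle_step': tle_step
    then show ?thesis using tle_step.IH by blast
  qed
qed

text \<open>This turns the inductive order into a segment number on a given ray, the form in which
  \<open>zigzag_acyclic\<close> applies.\<close>

lemma tle_ray:
  assumes "tle z y" "ray b x c" "0 \<le> k" "y = c k"
  shows "\<exists>n\<ge>k. z \<in> interval r (c n) (c (n + 1))"
  using assms
proof (induction arbitrary: k rule: tle.induct)
  case (tle_seg y)
  then show ?case using ray_par[of b x c k] by auto
next
  case (tle_step y)
  have "\<exists>n\<ge>k + 1. z \<in> interval r (c n) (c (n + 1))"
    using tle_step.IH[of "k + 1"] tle_step.prems ray_par[of b x c k] by simp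
  then obtain n where "k + 1 \<le> n" "z \<in> interval r (c n) (c (n + 1))" by blast
  then show ?case by (intro exI[of _ n]) simp
qed

text \<open>A ray never returns to its start: \<open>x\<close> would lie on the first segment and on
  a later one. Tightness at the first turning point rules out the second segment, acyclicity all the
  others.\<close>

lemma not_tle_par:
  assumes x: "x \<in> X" shows "\<not> tle x (par x)"
proof
  assume t: "tle x (par x)"
  obtain c where c: "ray (ty x) x c" "c 1 = par x" using ex_ray_par[OF x] .
  have z: "zigzag (ty x) {0..} c" "c 0 = x" using c by (auto simp: ray_def)
  obtain n where n: "1 \<le> n" "x \<in> interval r (c n) (c (n + 1))"
    using tle_ray[OF t c(1), of 1] c(2) by auto
  have x01: "x \<in> interval r (c 0) (c 1)" using x z(2) par_dle[OF x] c(2) seg_iff[OF x] by simp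
  show False
  proof (cases "n = 1")
    case True
    have "interval r x (c 1) \<inter> interval r (c 1) (c 2) = {c 1}"
      using tight_interval_Int[OF ray_tight[OF c(1)]] ray_X[OF c(1), of 1] by simp
    then show False using n(2) x01 z(2) True par_dle[OF x] c(2) by auto
  next
    case False
    have "zigzag (ty x) {0..n + 1} c" by (rule zigzag_mono[OF z(1)]) auto
    from zigzag_acyclic[OF this, of 0 n] show False using False n x01 by auto
  qed
qed

lemma tle_antisym:
  assumes "tle y x" "tle x y" shows "x = y"
proof -
  have x: "x \<in> X" and y: "y \<in> X" using assms tle_X by auto
  show ?thesis
    using assms(1)
  proof cases
    case tle_seg
    show ?thesis
    proof (cases "y = par x")
      case True then show ?thesis using not_tle_par[OF x] assms by simp
    next
      case False
      from assms(2) show ?thesis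
      proof cases
        case 1: tle_seg
        then show ?thesis
          using seg_mono[OF x \<open>y \<in> seg x\<close> False] \<open>y \<in> seg x\<close> seg_iff[OF x] dle_antisym by blast
      next
        case tle_step
        then show ?thesis using seg_ty_par[OF x \<open>y \<in> seg x\<close> False] not_tle_par[OF x] by simp
      qed
    qed
  next
    case tle_step
    then show ?thesis using tle_trans assms not_tle_par[OF x] by blast
  qed
qed

section \<open>Recovering inclusion from the tree\<close>

lemma dle_common_seg:
  assumes x: "x \<in> X" and y: "y \<in> X" and le: "dle (ty x) x y"
  shows "\<exists>z. z \<in> seg x \<and> (z = y \<or> z \<in> seg y \<and> ty y = (\<not> ty x))"
proof -
  obtain c where c: "ray (ty x) x c" "c 1 = par x" using ex_ray_par[OF x] .
  \<comment> \<open>The common point is \<open>y\<close> itself, \<open>par x\<close>, or the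
    branching point \<open>d 1\<close>, respectively.\<close>
  consider (1) "dle (ty x) y (c 1)"
    | (2) d where "dle (ty x) (c 1) y" "ray (\<not> ty x) y d" "d 1 = c 2"
    | (3) d where "ray (\<not> ty x) y d" "d 1 \<in> X" "dle (ty x) x (d 1)" "dle (ty x) (d 1) (c 1)"
        "dle (ty x) (d 1) y"
    using ray_comparable[OF c(1) y le] by blast
  then show ?thesis
  proof cases
    case 1 then show ?thesis using seg_iff[OF x] x y le c by auto
  next
    case 2
    have "par x \<in> seg x" using seg_iff[OF x] par_X[OF x] par_dle[OF x] by simp
    moreover have "par x \<in> seg y"
      using seg_iff[OF y] par_X[OF x] ray_ty_par[OF 2(2)] 2(1,3) tight_dle[OF ray_tight[OF c(1)]] c(2) by simp
    ultimately show ?thesis using ray_ty_par[OF 2(2)] by blast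
  next
    case 3
    have "d 1 \<in> seg x" using seg_iff[OF x] 3 c by simp
    moreover have "d 1 \<in> seg y" using seg_iff[OF y] ray_ty_par[OF 3(1)] 3 by simp
    ultimately show ?thesis using ray_ty_par[OF 3(1)] by blast
  qed
qed

text \<open>An ascent from \<open>u\<close> and a descent from \<open>v\<close>, both towards the
  end, meet in \<open>z\<close>. The case where the ray from \<open>u\<close> starts downwards and
  that from \<open>v\<close> upwards cannot occur, since the former prolongs to a ray starting
  downwards from \<open>v\<close>.\<close>

lemma subset_common_seg:
  assumes u: "u \<in> X" and v: "v \<in> X" and le: "u \<subseteq> v"
  shows "\<exists>z. (z = u \<or> z \<in> seg u \<and> ty u) \<and> (z = v \<or> z \<in> seg v \<and> \<not> ty v)"
proof -
  consider "ty u" | "\<not> ty v" | "\<not> ty u" "ty v" by blast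
  then show ?thesis
  proof cases
    case 1
    then show ?thesis using dle_common_seg[OF u v] le by (auto simp: dle_def)
  next
    case 2
    then show ?thesis using dle_common_seg[OF v u] le by (auto simp: dle_def)
  next
    case 3
    obtain c where c: "ray (ty u) u c" using ex_ray_par[OF u] by blast
    have "ray (ty u) v (c(0 := v))" by (rule ray_extend[OF c v]) (use 3 le in \<open>simp add: dle_def\<close>)
    from ray_ty_par(1)[OF this] show ?thesis using 3 by simp
  qed
qed

text \<open>At each comparability step the old and the new common point both lie on the ray from
  \<open>u\<close>, so they are comparable in the tree and the smaller one serves.\<close>

lemma ex_common_tle:
  assumes x: "x \<in> X" and y: "y \<in> X"
  shows "\<exists>z. tle z x \<and> tle z y"
proof (rule comparability_induct[OF x _ y])
  show "\<exists>z. tle z x \<and> tle z x" using tle_refl[OF x] by blast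
  fix u v
  assume "\<exists>z. tle z x \<and> tle z u" and uv: "u \<in> X" "v \<in> X" "u \<subseteq> v \<or> v \<subseteq> u"
  then obtain z where z: "tle z x" "tle z u" by blast
  have "\<exists>w. tle w u \<and> tle w v"
    using subset_common_seg[of u v] subset_common_seg[of v u] uv tle_refl tle_seg by metis
  then obtain w where w: "tle w u" "tle w v" by blast
  show "\<exists>z. tle z x \<and> tle z v" using tle_chain[OF z(2) w(1)] tle_trans z w by blast
qed

text \<open>The completion order is definable from the tree order and the predicate \<open>ty\<close>: \<open>up b x z\<close> says
  that the descent from \<open>x\<close> to \<open>z\<close> in the tree runs in the direction \<open>b\<close> of the completion throughout.\<close>

definition up :: "bool \<Rightarrow> 'a set \<Rightarrow> 'a set \<Rightarrow> bool" where
  "up b x z \<longleftrightarrow> tle z x \<and> (\<forall>w. tle w x \<longrightarrow> tle z w \<longrightarrow> w \<noteq> z \<longrightarrow> ty w = b)"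

lemma up_refl: "x \<in> X \<Longrightarrow> up b x x"
  unfolding up_def using tle_refl tle_antisym by blast

lemma up_seg:
  assumes x: "x \<in> X" and z: "z \<in> seg x"
  shows "up (ty x) x z"
  unfolding up_def
proof (intro conjI allI impI)
  show "tle z x" using tle_seg[OF x z] .
  fix w assume w: "tle w x" "tle z w" "w \<noteq> z"
  have not: "\<not> tle w (par x)" using tle_of_seg[OF x z] tle_antisym w by blast
  from w(1) show "ty w = ty x"
  proof cases
    case tle_seg
    moreover have "w \<noteq> par x" using not tle_refl par_X[OF x] by blast
    ultimately show ?thesis using seg_ty_par[OF x] by blast
  qed (use not in simp)
qed

text \<open>Types alternate at turning points, so a descent of constant type cannot go beyond
  \<open>par x\<close>; it stays within one segment, which is monotone.\<close>

lemma up_dle: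
  assumes u: "up b x z" shows "dle b x z"
proof -
  have t: "tle z x" and w: "\<And>w. \<lbrakk>tle w x; tle z w; w \<noteq> z\<rbrakk> \<Longrightarrow> ty w = b" using u by (auto simp: up_def)
  have x: "x \<in> X" using tle_X[OF t] by simp
  have tx: "ty x = b" if "x \<noteq> z" using w[OF tle_refl[OF x] t that] .
  from t show ?thesis
  proof cases
    case tle_seg then show ?thesis using tx seg_iff[OF x] by (cases "x = z") auto
  next
    case tle_step
    then have "x \<noteq> z" using not_tle_par[OF x] by blast
    then have "ty x = b" using tx by simp
    then have "z = par x" using w[OF tle_par[OF x] tle_step(2)] ty_par[OF x] by blast
    then show ?thesis using par_dle[OF x] \<open>ty x = b\<close> by simp
  qed
qed

lemma subset_iff_up:
  assumes "x \<in> X" "y \<in> X"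
  shows "x \<subseteq> y \<longleftrightarrow> (\<exists>z. up True x z \<and> up False y z)"
proof
  assume "x \<subseteq> y"
  from subset_common_seg[OF assms this]
  obtain z where z: "z = x \<or> z \<in> seg x \<and> ty x" "z = y \<or> z \<in> seg y \<and> \<not> ty y" by (elim exE conjE)
  have "up True x z" using z(1) up_refl[OF assms(1)] up_seg[OF assms(1), of z] by auto
  moreover have "up False y z" using z(2) up_refl[OF assms(2)] up_seg[OF assms(2), of z] by auto
  ultimately show "\<exists>z. up True x z \<and> up False y z" by blast
next
  assume "\<exists>z. up True x z \<and> up False y z"
  then obtain z where z: "up True x z" "up False y z" by blast
  show "x \<subseteq> y" using up_dle[OF z(1)] up_dle[OF z(2)] by (auto simp: dle_def)
qed

text \<open>Marking the image of \<open>A\<close> lets an automorphism of the tree restrict to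
  \<open>M\<close>. A colour of \<open>M\<close> is an arbitrary set of points, hence the
  intersection with \<open>A\<close>.\<close>

definition end_tree :: "'a set set \<Rightarrow> 'a set coloured_order" where
  "end_tree C = \<lparr>carrier = X, ord_rel = {(z, x). tle z x},
     colours = {under r ` A, {x. ty x}} \<union> (\<lambda>P. under r ` (P \<inter> A)) ` C\<rparr>"

lemma end_tree_simps [simp]:
  "carrier (end_tree C) = X" "(z, x) \<in> ord_rel (end_tree C) \<longleftrightarrow> tle z x"
  "colours (end_tree C) = {under r ` A, {x. ty x}} \<union> (\<lambda>P. under r ` (P \<inter> A)) ` C"
  by (auto simp: end_tree_def)

lemma coloured_tree_end_tree: "coloured_tree (end_tree C)"
  unfolding coloured_tree_def coloured_partial_order_def
proof (intro conjI ballI)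
  let ?R = "ord_rel (end_tree C)"
  have "?R \<subseteq> X \<times> X" using tle_X by (auto simp: end_tree_def)
  moreover have "refl_on X ?R" using tle_refl by (simp add: refl_on_def)
  moreover have "trans ?R" by (rule transI) (use tle_trans in auto)
  moreover have "antisym ?R" by (rule antisymI) (use tle_antisym in auto)
  ultimately show "partial_order_on (carrier (end_tree C)) ?R" by (simp add: order_on_defs)
  fix x assume x: "x \<in> carrier (end_tree C)"
  show "total_on (under ?R x) ?R" using tle_chain by (auto simp: total_on_def under_def)
  fix y assume y: "y \<in> carrier (end_tree C)"
  obtain z where z: "tle z x" "tle z y" using ex_common_tle x y by auto
  then have "z \<in> Under ?R {x, y}" unfolding Under_def Field_def by auto
  then show "Under ?R {x, y} \<noteq> {}" by blast
qed

end

section \<open>The automorphism groups\<close>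

context cycle_free_omega
begin

section \<open>Automorphisms of the completion and of the tree\<close>

lemma order_aut_zigzag:
  assumes h: "bij_betw h X X" "\<And>x y. x \<in> X \<Longrightarrow> y \<in> X \<Longrightarrow> h x \<subseteq> h y \<longleftrightarrow> x \<subseteq> y"
    and z: "zigzag b W c"
  shows "zigzag b W (\<lambda>i. h (c i))"
proof (rule zigzagI)
  have hX: "h x \<in> X" if "x \<in> X" for x using h(1) that by (rule bij_betwE[THEN bspec])
  have dle: "dle s (h x) (h y) \<longleftrightarrow> dle s x y" if "x \<in> X" "y \<in> X" for s x y
    using h(2) that by (simp add: dle_def)
  have eq: "h x = h y \<longleftrightarrow> x = y" if "x \<in> X" "y \<in> X" for x y
    using h(1) that by (auto simp: bij_betw_def inj_on_def)
  fix i
  { assume "i \<in> W" then show "h (c i) \<in> X" using hX zigzag_X[OF z] by blast }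
  { assume i: "i \<in> W" "i + 1 \<in> W"
    then show "dle (node b i) (h (c i)) (h (c (i + 1))) \<and> h (c i) \<noteq> h (c (i + 1))"
      using zigzag_edge[OF z i] dle eq zigzag_X[OF z] by simp }
  { assume i: "i - 1 \<in> W" "i \<in> W" "i + 1 \<in> W"
    note t = zigzag_tight[OF z i] and X = i[THEN zigzag_X[OF z]]
    have "w = h (c i)" if w: "w \<in> X" "dle (node b i) (h (c i)) w" "dle (node b i) w (h (c (i - 1)))"
      "dle (node b i) w (h (c (i + 1)))" for w
    proof -
      \<comment> \<open>Tightness quantifies over the whole completion; surjectivity of
        \<open>h\<close> pulls \<open>w\<close> back.\<close>
      obtain v where v: "v \<in> X" "w = h v" using h(1) w(1) by (auto simp: bij_betw_def)
      then have "v = c i" using tight_eq[OF t v(1)] w dle X by simp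
      then show ?thesis using v by simp
    qed
    then show "tight (node b i) (h (c (i - 1))) (h (c i)) (h (c (i + 1)))"
      using tight_dle[OF t] dle eq X unfolding tight_def by simp }
qed

lemma order_aut_ty_par:
  assumes h: "bij_betw h X X" "\<And>x y. x \<in> X \<Longrightarrow> y \<in> X \<Longrightarrow> h x \<subseteq> h y \<longleftrightarrow> x \<subseteq> y"
    and x: "x \<in> X"
  shows "ty (h x) = ty x" "par (h x) = h (par x)"
proof -
  obtain c where c: "ray (ty x) x c" "c 1 = par x" using ex_ray_par[OF x] .
  have "ray (ty x) (h x) (\<lambda>i. h (c i))" using order_aut_zigzag[OF h] c by (simp add: ray_def)
  from ray_ty_par[OF this] show "ty (h x) = ty x" "par (h x) = h (par x)" using c by auto
qed

lemma order_aut_tle: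
  assumes h: "bij_betw h X X" "\<And>x y. x \<in> X \<Longrightarrow> y \<in> X \<Longrightarrow> h x \<subseteq> h y \<longleftrightarrow> x \<subseteq> y"
    and X: "x \<in> X" "z \<in> X"
  shows "tle (h z) (h x) \<longleftrightarrow> tle z x"
proof -
  have hX: "h x \<in> X" if "x \<in> X" for x using h(1) that by (rule bij_betwE[THEN bspec])
  have seg: "h z \<in> seg (h x) \<longleftrightarrow> z \<in> seg x" if "x \<in> X" "z \<in> X" for x z
    using that hX h(2) par_X[of x] seg_iff[OF hX[OF that(1)], of "h z"] seg_iff[OF that(1), of z]
    by (simp add: order_aut_ty_par[OF h] dle_def)
  have 1: "tle (h z) (h x)" if "tle z x" for z x
    using that
  proof (induction rule: tle.induct)
    case (tle_seg x)
    then have "z \<in> X" by (simp add: seg_iff)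
    then show ?case using tle.tle_seg[OF hX] seg tle_seg by blast
  next
    case (tle_step x)
    then show ?case using tle.tle_step[OF hX] order_aut_ty_par(2)[OF h] by simp
  qed
  \<comment> \<open>The equations keep the images variable during the induction, so that no inverse
    of \<open>h\<close> has to be treated.\<close>
  have 2: "tle z x" if "tle w y" "y = h x" "w = h z" "x \<in> X" "z \<in> X" for w y z x
    using that
  proof (induction arbitrary: x rule: tle.induct)
    case (tle_seg y)
    then show ?case using tle.tle_seg[of x z] seg by simp
  next
    case (tle_step y)
    then have "tle z (par x)" using order_aut_ty_par(2)[OF h] par_X by simp
    then show ?case using tle.tle_step tle_step.prems by blast
  qed
  show ?thesis using 1 2 X by blast
qed

text \<open>By \<open>subset_iff_up\<close>, inclusion is expressed through the tree order and
  \<open>ty\<close>, both preserved by \<open>g\<close>; surjectivity lets the quantifiers over the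
  completion be relabelled by \<open>g\<close>.\<close>

lemma tree_aut_subset:
  assumes g: "bij_betw g X X" and tle: "\<And>x z. x \<in> X \<Longrightarrow> z \<in> X \<Longrightarrow> tle (g z) (g x) \<longleftrightarrow> tle z x"
    and ty: "\<And>x. x \<in> X \<Longrightarrow> ty (g x) = ty x"
    and X: "x \<in> X" "y \<in> X"
  shows "g x \<subseteq> g y \<longleftrightarrow> x \<subseteq> y"
proof -
  have gX: "g x \<in> X" if "x \<in> X" for x using g that by (rule bij_betwE[THEN bspec])
  have inj: "g x = g y \<longleftrightarrow> x = y" if "x \<in> X" "y \<in> X" for x y
    using g that by (auto simp: bij_betw_def inj_on_def)
  have surj: "(\<forall>w\<in>X. Q w) \<longleftrightarrow> (\<forall>w\<in>X. Q (g w))" for Q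
  proof -
    have "(\<forall>w\<in>g ` X. Q w) \<longleftrightarrow> (\<forall>w\<in>X. Q (g w))" by blast
    moreover have "g ` X = X" using g by (simp add: bij_betw_def)
    ultimately show ?thesis by simp
  qed
  have up_iff: "up b x z \<longleftrightarrow> tle z x \<and> (\<forall>w\<in>X. tle w x \<longrightarrow> tle z w \<longrightarrow> w \<noteq> z \<longrightarrow> ty w = b)" for b x z
    unfolding up_def using tle_X by blast
  have up: "up b (g x) (g z) \<longleftrightarrow> up b x z" if "x \<in> X" "z \<in> X" for b x z
    unfolding up_iff surj[of "\<lambda>w. tle w (g x) \<longrightarrow> tle (g z) w \<longrightarrow> w \<noteq> g z \<longrightarrow> ty w = b"]
    using tle ty inj that by simp
  have ex: "(\<exists>z. up True x z \<and> up False y z) \<longleftrightarrow> (\<exists>z\<in>X. up True x z \<and> up False y z)" for x y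
    unfolding up_def using tle_X by blast
  have "(\<exists>z\<in>X. up True (g x) z \<and> up False (g y) z) \<longleftrightarrow> (\<exists>z\<in>X. up True (g x) (g z) \<and> up False (g y) (g z))"
    using surj[of "\<lambda>z. \<not> (up True (g x) z \<and> up False (g y) z)"] by blast
  then show ?thesis
    using up X by (simp add: subset_iff_up[OF gX gX] subset_iff_up ex)
qed

end

section \<open>Order automorphisms act on the completion by images\<close>

lemma Under_Above_image:
  assumes f: "f ` A = A" "\<And>x y. x \<in> A \<Longrightarrow> y \<in> A \<Longrightarrow> (f x, f y) \<in> r \<longleftrightarrow> (x, y) \<in> r"
    and A: "Field r = A" "S \<subseteq> A"
  shows "Under r (f ` S) = f ` Under r S" "Above r (f ` S) = f ` Above r S"
proof -
  have iff: "(\<forall>a\<in>S. (f x, f a) \<in> r) \<longleftrightarrow> (\<forall>a\<in>S. (x, a) \<in> r)"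
    "(\<forall>a\<in>S. (f a, f x) \<in> r) \<longleftrightarrow> (\<forall>a\<in>S. (a, x) \<in> r)" if "x \<in> A" for x
    by (rule ball_cong[OF refl], use f(2) that A(2) in blast)+
  have "Under r (f ` S) = {y \<in> f ` A. \<forall>a\<in>S. (y, f a) \<in> r}" using A f(1) by (simp add: Under_def)
  also have "\<dots> = f ` {x \<in> A. \<forall>a\<in>S. (f x, f a) \<in> r}" by blast
  also have "\<dots> = f ` Under r S" using iff(1) A(1) by (simp add: Under_def cong: conj_cong)
  finally show "Under r (f ` S) = f ` Under r S" .
  have "Above r (f ` S) = {y \<in> f ` A. \<forall>a\<in>S. (f a, y) \<in> r}" using A f(1) by (simp add: Above_def)
  also have "\<dots> = f ` {x \<in> A. \<forall>a\<in>S. (f a, f x) \<in> r}" by blast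
  also have "\<dots> = f ` Above r S" using iff(2) A(1) by (simp add: Above_def cong: conj_cong)
  finally show "Above r (f ` S) = f ` Above r S" .
qed

lemma dm_completion_image_iff:
  assumes f: "bij_betw f A A" "\<And>x y. x \<in> A \<Longrightarrow> y \<in> A \<Longrightarrow> (f x, f y) \<in> r \<longleftrightarrow> (x, y) \<in> r"
    and A: "Field r = A" "J \<subseteq> A"
  shows "f ` J \<in> dm_completion r \<longleftrightarrow> J \<in> dm_completion r"
proof -
  have sub: "Above r J \<subseteq> A" "Under r (Above r J) \<subseteq> A" using A by (auto simp: Under_def Above_def)
  have sur: "f ` A = A" using f(1) by (simp add: bij_betw_def)
  have "Under r (Above r (f ` J)) = f ` Under r (Above r J)"
    using Under_Above_image[OF sur f(2) A(1)] A(2) sub(1) by simp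
  moreover have "f ` Under r (Above r J) = f ` J \<longleftrightarrow> Under r (Above r J) = J"
    using inj_on_image_eq_iff[OF _ sub(2) A(2), of f] f(1) by (simp add: bij_betw_def)
  moreover have "Above r (f ` J) = {} \<longleftrightarrow> Above r J = {}"
    using Under_Above_image(2)[OF sur f(2) A] by simp
  ultimately show ?thesis by (simp add: dm_completion_def)
qed

section \<open>The isomorphism of the automorphism groups\<close>

locale coloured_cycle_free_omega = cycle_free_omega "carrier M" "ord_rel M" for M :: "'a coloured_order"
begin

abbreviation "r \<equiv> ord_rel M"
abbreviation "T \<equiv> end_tree (colours M)"

text \<open>The action of \<open>f\<close> on the completion, restricted to \<open>X\<close> because
  \<open>Bij\<close> consists of extensional functions.\<close>

definition lift :: "('a \<Rightarrow> 'a) \<Rightarrow> 'a set \<Rightarrow> 'a set" where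
  "lift f = (\<lambda>J\<in>X. f ` J)"

lemma automorphismD:
  assumes "f \<in> automorphisms M"
  shows "bij_betw f (carrier M) (carrier M)" "f \<in> extensional (carrier M)"
    and "\<And>x y. x \<in> carrier M \<Longrightarrow> y \<in> carrier M \<Longrightarrow> (f x, f y) \<in> r \<longleftrightarrow> (x, y) \<in> r"
    and "\<And>P x. P \<in> colours M \<Longrightarrow> x \<in> carrier M \<Longrightarrow> f x \<in> P \<longleftrightarrow> x \<in> P"
  using assms by (auto simp: automorphisms_def Bij_def)

lemma image_under:
  assumes f: "f \<in> automorphisms M" and a: "a \<in> carrier M"
  shows "f ` under r a = under r (f a)"
proof -
  have sur: "f ` carrier M = carrier M" using automorphismD(1)[OF f] by (simp add: bij_betw_def)
  show ?thesis
  proof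
    show "f ` under r a \<subseteq> under r (f a)" using automorphismD(3)[OF f] a r_in by (auto simp: under_def)
    show "under r (f a) \<subseteq> f ` under r a"
    proof
      fix y assume y: "y \<in> under r (f a)"
      then have "y \<in> f ` carrier M" unfolding sur using r_in by (auto simp: under_def)
      then obtain x where x: "x \<in> carrier M" "y = f x" by blast
      then have "x \<in> under r a" using y automorphismD(3)[OF f x(1) a] by (simp add: under_def)
      then show "y \<in> f ` under r a" using x by blast
    qed
  qed
qed

lemma lift_automorphism:
  assumes f: "f \<in> automorphisms M"
  shows "lift f \<in> automorphisms T"
proof -
  note fD = automorphismD[OF f]
  have inj: "inj_on f (carrier M)" and sur: "f ` carrier M = carrier M"
    using fD(1) by (auto simp: bij_betw_def)
  have X_iff: "f ` J \<in> X \<longleftrightarrow> J \<in> X" if "J \<subseteq> carrier M" for J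
    using dm_completion_image_iff[OF fD(1,3) Field_r that] .
  have lift: "lift f J = f ` J" if "J \<in> X" for J using that by (simp add: lift_def)
  have bij: "bij_betw (lift f) X X"
  proof (rule bij_betwI')
    fix J K assume JK: "J \<in> X" "K \<in> X"
    show "lift f J = lift f K \<longleftrightarrow> J = K"
      unfolding lift[OF JK(1)] lift[OF JK(2)]
      by (rule inj_on_image_eq_iff[OF inj X_subset[OF JK(1)] X_subset[OF JK(2)]])
  next
    fix J assume J: "J \<in> X"
    show "lift f J \<in> X" unfolding lift[OF J] X_iff[OF X_subset[OF J]] by (rule J)
  next
    fix K assume K: "K \<in> X"
    let ?J = "{a \<in> carrier M. f a \<in> K}"
    have "f ` ?J = f ` carrier M \<inter> K" by auto
    then have eq: "f ` ?J = K" unfolding sur using X_subset[OF K] by (simp add: Int_absorb1)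
    have "f ` ?J \<in> X" unfolding eq by (rule K)
    then have J: "?J \<in> X" by (subst (asm) X_iff) auto
    show "\<exists>J\<in>X. K = lift f J" by (rule bexI[OF _ J]) (simp only: lift[OF J] eq)
  qed
  have sub: "lift f J \<subseteq> lift f K \<longleftrightarrow> J \<subseteq> K" if "J \<in> X" "K \<in> X" for J K
  proof -
    have "f a \<in> f ` K \<longleftrightarrow> a \<in> K" if "a \<in> J" for a
      using inj_on_image_mem_iff[OF inj _ X_subset[OF \<open>K \<in> X\<close>]] X_subset[OF \<open>J \<in> X\<close>] that by blast
    then show ?thesis unfolding lift[OF that(1)] lift[OF that(2)] by (simp add: image_subset_iff subset_eq)
  qed
  \<comment> \<open>Stated for any set \<open>P\<close> respected by \<open>f\<close>, so that
    \<open>UNIV\<close> covers the colour marking the points of \<open>M\<close>.\<close>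
  have colour: "lift f J \<in> under r ` (P \<inter> carrier M) \<longleftrightarrow> J \<in> under r ` (P \<inter> carrier M)"
    if J: "J \<in> X" and P: "\<And>x. x \<in> carrier M \<Longrightarrow> f x \<in> P \<longleftrightarrow> x \<in> P" for J P
  proof
    assume "lift f J \<in> under r ` (P \<inter> carrier M)"
    then obtain b where b: "b \<in> P" "b \<in> carrier M" "f ` J = under r b" using lift[OF J] by auto
    then obtain a where a: "a \<in> carrier M" "b = f a" using sur by blast
    have "f ` J = f ` under r a" using b a image_under[OF f a(1)] by simp
    then have "J = under r a"
      using inj_on_image_eq_iff[OF inj X_subset[OF J] X_subset[OF under_X[OF a(1)]]] by simp
    then show "J \<in> under r ` (P \<inter> carrier M)" using a b P by blast
  next
    assume "J \<in> under r ` (P \<inter> carrier M)"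
    then obtain a where a: "a \<in> P" "a \<in> carrier M" "J = under r a" by blast
    then have "lift f J = under r (f a)" using lift[OF J] image_under[OF f] by simp
    moreover have "f a \<in> P \<inter> carrier M" using a P sur by blast
    ultimately show "lift f J \<in> under r ` (P \<inter> carrier M)" by blast
  qed
  show ?thesis
    unfolding automorphisms_def
  proof (intro CollectI conjI ballI)
    show "lift f \<in> Bij (carrier T)" using bij by (simp add: Bij_def lift_def)
    fix J K assume "J \<in> carrier T" "K \<in> carrier T"
    then show "(lift f J, lift f K) \<in> ord_rel T \<longleftrightarrow> (J, K) \<in> ord_rel T"
      using order_aut_tle[OF bij sub] by simp
  next
    fix Q J assume Q: "Q \<in> colours T" and "J \<in> carrier T"
    then have J: "J \<in> X" by simp
    from Q consider "Q = under r ` carrier M" | "Q = {x. ty x}"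
      | P where "P \<in> colours M" "Q = under r ` (P \<inter> carrier M)" by auto
    then show "lift f J \<in> Q \<longleftrightarrow> J \<in> Q"
    proof cases
      case 1 then show ?thesis using colour[OF J, of UNIV] by simp
    next
      case 2 then show ?thesis using order_aut_ty_par(1)[OF bij sub J] by simp
    next
      case 3 then show ?thesis using colour[OF J, of P] fD(4) by blast
    qed
  qed
qed

text \<open>\<open>lift f\<close> takes the principal ideal of \<open>a\<close> to that of
  \<open>f a\<close>, so \<open>f\<close> can be read off from it.\<close>

lemma lift_inj: "inj_on lift (automorphisms M)"
proof (rule inj_onI)
  fix f g assume fg: "f \<in> automorphisms M" "g \<in> automorphisms M" and eq: "lift f = lift g"
  show "f = g"
  proof (rule extensionalityI[OF automorphismD(2)[OF fg(1)] automorphismD(2)[OF fg(2)]])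
    fix a assume a: "a \<in> carrier M"
    have fa: "f a \<in> carrier M" "g a \<in> carrier M"
      using automorphismD(1)[OF fg(1)] automorphismD(1)[OF fg(2)] a by (auto simp: bij_betw_def)
    have "lift f (under r a) = lift g (under r a)" using eq by simp
    then have "under r (f a) = under r (g a)"
      using under_X[OF a] image_under[OF fg(1) a] image_under[OF fg(2) a] by (simp add: lift_def)
    then show "f a = g a" using under_inject fa by simp
  qed
qed

text \<open>\<open>g\<close> preserves inclusion by \<open>tree_aut_subset\<close> and the marked
  points of \<open>M\<close> by its colours, which yields \<open>f\<close>. An element of the
  completion is determined by the principal ideals it contains, so \<open>g\<close> agrees with
  \<open>lift f\<close> everywhere.\<close>

lemma lift_surj:
  assumes g: "g \<in> automorphisms T"
  shows "g \<in> lift ` automorphisms M"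
proof -
  have bij: "bij_betw g X X" and ext: "g \<in> extensional X"
    using g by (auto simp: automorphisms_def Bij_def)
  have tle: "tle (g z) (g x) \<longleftrightarrow> tle z x" if "x \<in> X" "z \<in> X" for x z
    using g that by (simp add: automorphisms_def)
  have col: "g J \<in> Q \<longleftrightarrow> J \<in> Q" if "Q \<in> colours T" "J \<in> X" for Q J
    using g that unfolding automorphisms_def end_tree_simps(1) by blast
  have ty: "ty (g x) = ty x" if "x \<in> X" for x using col[of "{x. ty x}" x] that by simp
  have sub: "g x \<subseteq> g y \<longleftrightarrow> x \<subseteq> y" if "x \<in> X" "y \<in> X" for x y
    using tree_aut_subset[OF bij tle ty that] .
  have gX: "g x \<in> X" if "x \<in> X" for x using bij that by (rule bij_betwE[THEN bspec])
  have "\<forall>a\<in>carrier M. \<exists>b. b \<in> carrier M \<and> under r b = g (under r a)"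
  proof
    fix a assume a: "a \<in> carrier M"
    have "g (under r a) \<in> under r ` carrier M" using col[of "under r ` carrier M" "under r a"] a under_X by simp
    then show "\<exists>b. b \<in> carrier M \<and> under r b = g (under r a)" by auto
  qed
  then obtain f0 where f0: "\<forall>a\<in>carrier M. f0 a \<in> carrier M \<and> under r (f0 a) = g (under r a)"
    unfolding bchoice_iff by blast
  define f where "f = restrict f0 (carrier M)"
  have f: "f a \<in> carrier M" "under r (f a) = g (under r a)" if "a \<in> carrier M" for a
    using f0 that by (auto simp: f_def)
  have ord: "(f a, f b) \<in> r \<longleftrightarrow> (a, b) \<in> r" if "a \<in> carrier M" "b \<in> carrier M" for a b
    using sub[OF under_X under_X, OF that] f(2) that under_subset_iff[OF that(1), of b]
      under_subset_iff[OF f(1)[OF that(1)], of "f b"] by simp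
  have bijf: "bij_betw f (carrier M) (carrier M)"
  proof (rule bij_betwI')
    fix a b assume ab: "a \<in> carrier M" "b \<in> carrier M"
    show "f a = f b \<longleftrightarrow> a = b" using ord[of a b] ord[of b a] r_refl f(1) ab r_antisym by metis
  next
    fix a assume "a \<in> carrier M" then show "f a \<in> carrier M" by (rule f)
  next
    fix b assume b: "b \<in> carrier M"
    obtain J where J: "J \<in> X" "g J = under r b"
      using bij under_X[OF b] by (metis bij_betw_def imageE)
    have "J \<in> under r ` carrier M" using col[of "under r ` carrier M" J] J b by simp
    then obtain a where a: "a \<in> carrier M" "J = under r a" by blast
    then have "under r b = under r (f a)" using J f by simp
    then have "b = f a" using under_inject b f(1) a by simp
    then show "\<exists>a\<in>carrier M. b = f a" using a by blast
  qed
  have "f \<in> automorphisms M"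
    unfolding automorphisms_def
  proof (intro CollectI conjI ballI)
    show "f \<in> Bij (carrier M)" using bijf by (simp add: Bij_def f_def)
    show "(f x, f y) \<in> r \<longleftrightarrow> (x, y) \<in> r" if "x \<in> carrier M" "y \<in> carrier M" for x y using ord that .
    fix P a assume P: "P \<in> colours M" and a: "a \<in> carrier M"
    have mem: "under r b \<in> under r ` (P \<inter> carrier M) \<longleftrightarrow> b \<in> P" if "b \<in> carrier M" for b
      using under_inject that by auto
    have "g (under r a) \<in> under r ` (P \<inter> carrier M) \<longleftrightarrow> under r a \<in> under r ` (P \<inter> carrier M)"
      using col P under_X[OF a] by simp
    then show "f a \<in> P \<longleftrightarrow> a \<in> P" using mem[OF a] mem[OF f(1)[OF a]] f(2)[OF a] by simp
  qed
  moreover have "g = lift f"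
  proof (rule extensionalityI[OF ext])
    show "lift f \<in> extensional X" by (simp add: lift_def)
    fix J assume J: "J \<in> X"
    have mem: "b \<in> g J \<longleftrightarrow> b \<in> f ` J" if "b \<in> carrier M" for b
    proof -
      have "b \<in> f ` carrier M" using that bijf by (simp add: bij_betw_def)
      then obtain a where a: "a \<in> carrier M" "b = f a" by blast
      have "f a \<in> g J \<longleftrightarrow> under r (f a) \<subseteq> g J" using under_subset_X_iff[OF gX[OF J] f(1)[OF a(1)]] by simp
      also have "\<dots> \<longleftrightarrow> under r a \<subseteq> J" using f(2)[OF a(1)] sub[OF under_X[OF a(1)] J] by simp
      also have "\<dots> \<longleftrightarrow> a \<in> J" using under_subset_X_iff[OF J a(1)] .
      also have "\<dots> \<longleftrightarrow> f a \<in> f ` J"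
        using inj_on_image_mem_iff[of f "carrier M" a J] bijf a X_subset[OF J] by (simp add: bij_betw_def)
      finally show ?thesis using a by simp
    qed
    have "f ` J \<subseteq> carrier M"
      using image_mono[OF X_subset[OF J], of f] bijf by (simp add: bij_betw_def)
    then have "b \<in> g J \<longleftrightarrow> b \<in> f ` J" for b
      using mem[of b] X_subset[OF gX[OF J]] by (cases "b \<in> carrier M") (simp, meson subsetD)
    then have "g J = f ` J" by (simp add: set_eq_iff)
    then show "g J = lift f J" using J by (simp add: lift_def)
  qed
  ultimately show ?thesis by blast
qed

lemma Aut_iso_end_tree: "Aut M \<cong> Aut T"
proof (rule is_isoI, rule isoI)
  have cM: "carrier (Aut M) = automorphisms M" and cT: "carrier (Aut T) = automorphisms T"
    by (simp_all add: Aut_def)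
  have mM: "f \<otimes>\<^bsub>Aut M\<^esub> g = compose (carrier M) f g" if "f \<in> automorphisms M" "g \<in> automorphisms M" for f g
    using that by (simp add: Aut_def BijGroup_def automorphisms_def)
  have mT: "f \<otimes>\<^bsub>Aut T\<^esub> g = compose X f g" if "f \<in> automorphisms T" "g \<in> automorphisms T" for f g
    using that by (simp add: Aut_def BijGroup_def automorphisms_def)
  show "lift \<in> hom (Aut M) (Aut T)"
  proof (rule homI)
    fix f assume "f \<in> carrier (Aut M)" then show "lift f \<in> carrier (Aut T)"
      using lift_automorphism cM cT by simp
  next
    fix f g assume "f \<in> carrier (Aut M)" "g \<in> carrier (Aut M)"
    then have fg: "f \<in> automorphisms M" "g \<in> automorphisms M" using cM by auto
    have lg: "lift g J \<in> X" if "J \<in> X" for J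
      using lift_automorphism[OF fg(2)] that by (auto simp: automorphisms_def Bij_def bij_betw_def)
    have "lift (compose (carrier M) f g) = compose X (lift f) (lift g)"
    proof (rule extensionalityI[of _ X])
      fix J assume J: "J \<in> X"
      have "compose (carrier M) f g ` J = f ` g ` J" using X_subset[OF J] by (force simp: compose_def)
      then show "lift (compose (carrier M) f g) J = compose X (lift f) (lift g) J"
        using J lg[OF J] by (simp add: lift_def compose_def)
    qed (simp_all add: lift_def)
    then show "lift (f \<otimes>\<^bsub>Aut M\<^esub> g) = lift f \<otimes>\<^bsub>Aut T\<^esub> lift g"
      using mM[OF fg] mT lift_automorphism fg by simp
  qed
  show "bij_betw lift (carrier (Aut M)) (carrier (Aut T))"
    unfolding bij_betw_def cM cT using lift_inj lift_automorphism lift_surj by blast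
qed

end

theorem mainTheorem11:
  fixes M :: "'a coloured_order"
  assumes "CFPO_omega M"
    and "connected_CFPO M"
  shows "treelike M"
proof -
  interpret coloured_cycle_free_omega M
  proof
    show "partial_order_on (carrier M) (ord_rel M)"
      using assms by (simp add: connected_CFPO_def CFPO_def coloured_partial_order_def)
    show "p = q" if "a \<in> carrier M" "b \<in> carrier M" "is_path (ord_rel M) a b p" "is_path (ord_rel M) a b q"
      for a b p q
      using assms that by (auto simp: connected_CFPO_def CFPO_def dest: Uniq_D)
  qed (use assms in \<open>auto simp: CFPO_omega_def connected_CFPO_def\<close>)
  show ?thesis using Aut_iso_end_tree coloured_tree_end_tree unfolding treelike_def by blast
qed

end
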